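(* Let $0<D<\infty$ and $0\le W<\infty$. There exist constants $c_W>0$ (depending only on $W$) and $C_{D,W}<\infty$ (depending only on $D,W$) such that the following holds. Let $\mathcal G_N=(\mathcal U_N\sqcup\mathcal W_N,\mathcal E_N)$ be a sequence of finite bipartite graphs with maximum vertex degree $\Delta(\mathcal G_N)\le D$ for every $N$, let $w_N=(w_{N,e})_{e\in\mathcal E_N}$ be real edge weights with $|w_{N,e}|\le W$ for all $e\in\mathcal E_N$ and all $N$, and for each $e\in\mathcal E_N$ let $\xi_{N,e}$ be a real random variable with $\mathbb E[\xi_{N,e}]=0$ and $s_{N,e}^2:=\mathbb E[\xi_{N,e}^2]<\infty$. Let $\mu_{w_N}$ be the weighted matching measure with edge weights $w_N$, and let $\mu_{\widetilde w_N}$ be the weighted matching measure with edge weights $\widetilde w_N$, which is the invariant distribution of the noisy single-edge Gibbs kernel with noise $(\xi_{N,e})_{e\in\mathcal E_N}$. If $$\max_{e\in\mathcal E_N}s_{N,e}^2\le c_W,$$ then $$d_{\mathrm H}^2(\mu_{\widetilde w_N},\mu_{w_N})\le C_{D,W}\sum_{e\in\mathcal E_N}s_{N,e}^4 .$$ Consequently, if $N_{\mathcal E}=|\mathcal E_N|$ and $s_{N,e}\le s_N$ for all $e\in\mathcal E_N$, then $d_{\mathrm H}(\mu_{\widetilde w_N},\mu_{w_N})\to0$ as $N\to\infty$ whenever $s_N=o(N_{\mathcal E}^{-1/4})$.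
   Context: Let $\mathcal G=(\mathcal U\sqcup\mathcal W,\mathcal E)$ be a finite bipartite graph. $\Omega_{\mathcal G}$ is the set of matchings of $\mathcal G$, i.e. subsets $M\subseteq\mathcal E$ in which no two distinct edges share an endpoint (the empty set included). For real edge weights $w=(w_e)_{e\in\mathcal E}$, the weighted matching measure is $\mu_w(M)=\mathcal Z_{\mathcal G,w}^{-1}\exp\left\{\sum_{e\in M}w_e\right\}$, $M\in\Omega_{\mathcal G}$, with $\mathcal Z_{\mathcal G,w}$ the normalizing constant. Let $\chi(t)=e^t/(1+e^t)$ and $\mathrm{logit}(p)=\log(p/(1-p))$. Given noise variables $\xi_e$, the modified weights are $\widetilde p_e=\mathbb E[\chi(w_e+\xi_e)]\in(0,1)$ and $\widetilde w_e=\mathrm{logit}(\widetilde p_e)$, for $e\in\mathcal E$. The noisy single-edge Gibbs kernel $\widetilde K$ on $\Omega_{\mathcal G}$ is: from $M$, pick $e\in\mathcal E$ uniformly; let $I_e(M)=1$ if no edge of $M$ other than $e$ shares an endpoint with $e$, and $I_e(M)=0$ otherwise; if $I_e(M)=1$ draw a fresh independent copy of $\xi_e$; draw $B\sim\mathrm{Bernoulli}(I_e(M)\chi(w_e+\xi_e))$; move to $M\cup\{e\}$ if $B=1$ and to $M\setminus\{e\}$ if $B=0$. Its invariant distribution is $\mu_{\widetilde w}$. $d_{\mathrm H}(\nu,\mu)=\left(\sum_M(\sqrt{\nu(M)}-\sqrt{\mu(M)})^2\right)^{1/2}$. *)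

theory Defs
  imports "HOL-Probability.Probability" "HOL-Library.Landau_Symbols"
begin

text \<open>
  An edge is the two-element set of its endpoints, one in each part, so two edges share an
  endpoint iff they intersect.
\<close>

definition bipartite_graph :: "'v set \<Rightarrow> 'v set \<Rightarrow> 'v set set \<Rightarrow> bool" where
  "bipartite_graph U V E \<longleftrightarrow>
     finite U \<and> finite V \<and> U \<inter> V = {} \<and> E \<subseteq> {{u, v} | u v. u \<in> U \<and> v \<in> V}"

definition vertex_degree :: "'v set set \<Rightarrow> 'v \<Rightarrow> nat" where
  "vertex_degree E v = card {e \<in> E. v \<in> e}"

definition matchings :: "'v set set \<Rightarrow> 'v set set set" where
  "matchings E = {M. M \<subseteq> E \<and> (\<forall>e\<in>M. \<forall>f\<in>M. e \<noteq> f \<longrightarrow> e \<inter> f = {})}"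

definition partition_function :: "'v set set \<Rightarrow> ('v set \<Rightarrow> real) \<Rightarrow> real" where
  "partition_function E w = (\<Sum>M\<in>matchings E. exp (\<Sum>e\<in>M. w e))"

text \<open>Distributions on the finite set of matchings are represented by their mass functions.\<close>

definition matching_measure :: "'v set set \<Rightarrow> ('v set \<Rightarrow> real) \<Rightarrow> 'v set set \<Rightarrow> real" where
  "matching_measure E w M = exp (\<Sum>e\<in>M. w e) / partition_function E w"

definition logistic :: "real \<Rightarrow> real" where
  "logistic t = exp t / (1 + exp t)"

definition logit :: "real \<Rightarrow> real" where
  "logit p = ln (p / (1 - p))"

text \<open>
  The noise variable of the edge \<open>e\<close> is \<open>\<xi> e\<close>, living on its own probability space \<open>P e\<close>.
\<close>

definition modified_prob ::
  "('v set \<Rightarrow> 'a measure) \<Rightarrow> ('v set \<Rightarrow> 'a \<Rightarrow> real) \<Rightarrow> ('v set \<Rightarrow> real) \<Rightarrow> 'v set \<Rightarrow> real" where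
  "modified_prob P \<xi> w e = (\<integral>\<omega>. logistic (w e + \<xi> e \<omega>) \<partial>P e)"

definition modified_weight ::
  "('v set \<Rightarrow> 'a measure) \<Rightarrow> ('v set \<Rightarrow> 'a \<Rightarrow> real) \<Rightarrow> ('v set \<Rightarrow> real) \<Rightarrow> 'v set \<Rightarrow> real" where
  "modified_weight P \<xi> w e = logit (modified_prob P \<xi> w e)"

definition noise_sd :: "'a measure \<Rightarrow> ('a \<Rightarrow> real) \<Rightarrow> real" where
  "noise_sd P X = sqrt (\<integral>\<omega>. (X \<omega>)\<^sup>2 \<partial>P)"

definition edge_free :: "'v set set \<Rightarrow> 'v set \<Rightarrow> bool" where
  "edge_free M e \<longleftrightarrow> (\<forall>f\<in>M. f \<noteq> e \<longrightarrow> f \<inter> e = {})"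

definition edge_update :: "'v set \<Rightarrow> 'v set set \<Rightarrow> bool \<Rightarrow> 'v set set" where
  "edge_update e M B = (if B then M \<union> {e} else M - {e})"

text \<open>
  One-step transition probability from \<open>M\<close> to \<open>M'\<close>: the average, over the uniformly chosen
  edge \<open>e\<close> and the fresh noise, of the conditional probability that the update by the
  Bernoulli variable yields \<open>M'\<close>.  If \<open>e\<close> is blocked, the integrand does not depend on the
  noise, so it is immaterial that the noise is integrated in this case, too.
  The kernel is meaningful only for nonempty \<open>E\<close>, since it starts by choosing an edge.
\<close>

definition noisy_gibbs_kernel ::
  "'v set set \<Rightarrow> ('v set \<Rightarrow> 'a measure) \<Rightarrow> ('v set \<Rightarrow> 'a \<Rightarrow> real) \<Rightarrow> ('v set \<Rightarrow> real)
     \<Rightarrow> 'v set set \<Rightarrow> 'v set set \<Rightarrow> real" where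
  "noisy_gibbs_kernel E P \<xi> w M M' =
     (\<Sum>e\<in>E. (\<integral>\<omega>. pmf (map_pmf (edge_update e M)
                     (bernoulli_pmf (of_bool (edge_free M e) * logistic (w e + \<xi> e \<omega>)))) M' \<partial>P e))
     / real (card E)"

definition invariant_distribution :: "'s set \<Rightarrow> ('s \<Rightarrow> 's \<Rightarrow> real) \<Rightarrow> ('s \<Rightarrow> real) \<Rightarrow> bool" where
  "invariant_distribution S K \<nu> \<longleftrightarrow>
     (\<forall>x\<in>S. 0 \<le> \<nu> x) \<and> (\<Sum>x\<in>S. \<nu> x) = 1 \<and> (\<forall>y\<in>S. (\<Sum>x\<in>S. \<nu> x * K x y) = \<nu> y)"

definition hellinger_dist :: "'s set \<Rightarrow> ('s \<Rightarrow> real) \<Rightarrow> ('s \<Rightarrow> real) \<Rightarrow> real" where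
  "hellinger_dist S \<nu> \<mu> = sqrt (\<Sum>x\<in>S. (sqrt (\<nu> x) - sqrt (\<mu> x))\<^sup>2)"

end

(*
  The covariance matrix of the edge indicators under a weighted matching measure has absolute row
  sums at most 1 + 2B, where B bounds the total activity sum_{e at u} exp(w_e) at each vertex.
  Indeed, conditioning on the edge that covers a vertex v expresses the effect of deleting v on the
  edge marginals as a combination, with total mass P(v covered) <= B / (1 + B), of the effects of
  deleting a neighbour of v from the graph without v, plus the indicator of the covering edge.
  Hence the total influence T of a vertex satisfies T <= B / (1 + B) * (T + 1), i.e. T <= B, and
  requiring an edge to be present amounts to deleting its two endpoints.

  Minus the logarithm of the Hellinger affinity of two matching measures is the midpoint convexity
  defect of log Z along the segment between their weights. The second derivative of log Z there is
  the variance of sum_{e in M} delta_e, which is thus at most (1 + 2B) * sum_e delta_e^2.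
  A second order Taylor expansion of the logistic function, whose linear term vanishes because the
  noise is centred, yields |delta_e| = O(s_e^2).
*)
theory Submission
  imports Defs
begin

section \<open>Vertex influence and edge covariances\<close>

text \<open>Vertex deletion. An edge is itself a set of vertices, so \<open>avoiding E e\<close>
  deletes both endpoints of \<open>e\<close>: these are the edges still available once
  \<open>e\<close> is in the matching.\<close>

definition avoiding :: "'v set set \<Rightarrow> 'v set \<Rightarrow> 'v set set" where
  "avoiding E A = {e \<in> E. e \<inter> A = {}}"

definition matching_weight :: "('v set \<Rightarrow> real) \<Rightarrow> 'v set set \<Rightarrow> real" where
  "matching_weight w M = exp (\<Sum>e\<in>M. w e)"

text \<open>An edge outside \<open>E\<close> has marginal 0. Marginals of a graph and of its
  subgraphs can therefore be compared edge by edge over one index set.\<close>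

definition edge_marginal :: "'v set set \<Rightarrow> ('v set \<Rightarrow> real) \<Rightarrow> 'v set \<Rightarrow> real" where
  "edge_marginal E w f = (\<Sum>M\<in>matchings E. of_bool (f \<in> M) * matching_measure E w M)"

definition edge_covariance :: "'v set set \<Rightarrow> ('v set \<Rightarrow> real) \<Rightarrow> 'v set \<Rightarrow> 'v set \<Rightarrow> real" where
  "edge_covariance E w e f =
     (\<Sum>M\<in>matchings E. of_bool (e \<in> M) * of_bool (f \<in> M) * matching_measure E w M)
       - edge_marginal E w e * edge_marginal E w f"

section \<open>Matchings, weights and partition functions\<close>

lemma finite_avoiding: "finite E \<Longrightarrow> finite (avoiding E A)"
  by (simp add: avoiding_def)

lemma avoiding_avoiding: "avoiding (avoiding E A) B = avoiding E (A \<union> B)"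
  by (auto simp: avoiding_def)

lemma finite_matchings: "finite E \<Longrightarrow> finite (matchings E)"
  by (rule finite_subset[of _ "Pow E"]) (auto simp: matchings_def)

lemma finite_matching: "finite E \<Longrightarrow> M \<in> matchings E \<Longrightarrow> finite M"
  by (auto simp: matchings_def intro: finite_subset)

lemma empty_in_matchings: "{} \<in> matchings E"
  by (simp add: matchings_def)

lemma matchings_mono: "E \<subseteq> F \<Longrightarrow> matchings E \<subseteq> matchings F"
  by (auto simp: matchings_def)

lemma matching_weight_pos: "matching_weight w M > 0"
  by (simp add: matching_weight_def)

lemma matching_weight_insert:
  "finite M \<Longrightarrow> e \<notin> M \<Longrightarrow> matching_weight w (insert e M) = exp (w e) * matching_weight w M"
  by (simp add: matching_weight_def exp_add)

lemma partition_function_eq: "partition_function E w = (\<Sum>M\<in>matchings E. matching_weight w M)"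
  by (simp add: partition_function_def matching_weight_def)

lemma matching_measure_eq:
  "matching_measure E w M = matching_weight w M / partition_function E w"
  by (simp add: matching_measure_def matching_weight_def)

lemma partition_function_pos: "finite E \<Longrightarrow> partition_function E w > 0"
  unfolding partition_function_eq
  by (rule sum_pos) (use empty_in_matchings in \<open>auto simp: finite_matchings matching_weight_pos\<close>)

lemma matching_measure_pos: "finite E \<Longrightarrow> matching_measure E w M > 0"
  by (simp add: matching_measure_eq matching_weight_pos partition_function_pos)

lemma sum_matching_measure: "finite E \<Longrightarrow> (\<Sum>M\<in>matchings E. matching_measure E w M) = 1"
  using partition_function_pos[of E w]
  by (simp add: matching_measure_eq sum_divide_distrib[symmetric] partition_function_eq)

lemma partition_function_mono:
  assumes "finite F" "E \<subseteq> F"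
  shows "partition_function E w \<le> partition_function F w"
  unfolding partition_function_eq using assms
  by (intro sum_mono2)
    (auto simp: finite_matchings less_imp_le[OF matching_weight_pos] dest: matchings_mono)

section \<open>Conditioning on an edge and on a vertex\<close>

lemma matchings_containing:
  assumes "e \<in> E" "e \<noteq> {}"
  shows "{M \<in> matchings E. e \<in> M} = insert e ` matchings (avoiding E e)"
proof (intro equalityI subsetI)
  fix M assume M: "M \<in> {M \<in> matchings E. e \<in> M}"
  then have "M - {e} \<in> matchings (avoiding E e)"
    by (auto simp: matchings_def avoiding_def)
  moreover have "M = insert e (M - {e})" using M by auto
  ultimately show "M \<in> insert e ` matchings (avoiding E e)" by blast
next
  fix M assume "M \<in> insert e ` matchings (avoiding E e)"
  then obtain M' where M': "M' \<in> matchings (avoiding E e)" "M = insert e M'" by auto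
  then have "\<forall>f\<in>M'. f \<inter> e = {}" "M' \<subseteq> E" by (auto simp: matchings_def avoiding_def)
  with M' assms show "M \<in> {M \<in> matchings E. e \<in> M}"
    by (auto simp: matchings_def)
qed

lemma notin_matchings_avoiding:
  "e \<noteq> {} \<Longrightarrow> M \<in> matchings (avoiding E e) \<Longrightarrow> e \<notin> M"
  by (auto simp: matchings_def avoiding_def)

text \<open>Reindexing by \<open>insert e\<close>, which is injective on the matchings of
  \<open>avoiding E e\<close>: a nonempty \<open>e\<close> meets itself and so is not an edge of
  that graph.\<close>

lemma sum_matchings_containing:
  fixes F :: "'v set set \<Rightarrow> real"
  assumes "finite E" "e \<in> E" "e \<noteq> {}"
  shows "(\<Sum>M\<in>matchings E. of_bool (e \<in> M) * F M)
    = (\<Sum>M\<in>matchings (avoiding E e). F (insert e M))"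
proof -
  have "(\<Sum>M\<in>matchings E. of_bool (e \<in> M) * F M) = (\<Sum>M\<in>{M \<in> matchings E. e \<in> M}. F M)"
    by (rule sum.mono_neutral_cong_right) (use assms in \<open>auto simp: finite_matchings\<close>)
  also have "\<dots> = (\<Sum>M\<in>matchings (avoiding E e). F (insert e M))"
    unfolding matchings_containing[OF assms(2,3)]
  proof (subst sum.reindex)
    show "inj_on (insert e) (matchings (avoiding E e))"
      using notin_matchings_avoiding[OF assms(3)]
      by (intro inj_onI) (metis insert_ident)
  qed simp
  finally show ?thesis .
qed

text \<open>A matching either leaves \<open>v\<close> uncovered, and is then a matching of the graph
  without \<open>v\<close>, or contains exactly one edge at \<open>v\<close>.\<close>

lemma sum_matchings_split_vertex:
  fixes F :: "'v set set \<Rightarrow> real"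
  assumes fin: "finite E"
  shows "(\<Sum>M\<in>matchings E. F M) = (\<Sum>M\<in>matchings (avoiding E {v}). F M)
    + (\<Sum>e\<in>{e\<in>E. v \<in> e}. \<Sum>M\<in>matchings (avoiding E e). F (insert e M))"
proof -
  have split: "F M = of_bool (M \<in> matchings (avoiding E {v})) * F M
      + (\<Sum>e\<in>{e\<in>E. v \<in> e}. of_bool (e \<in> M) * F M)" if M: "M \<in> matchings E" for M
  proof (cases "M \<in> matchings (avoiding E {v})")
    case True
    then have "\<forall>e\<in>{e\<in>E. v \<in> e}. e \<notin> M" by (auto simp: matchings_def avoiding_def)
    then have "(\<Sum>e\<in>{e\<in>E. v \<in> e}. of_bool (e \<in> M) * F M) = 0"
      by (intro sum.neutral) auto
    with True show ?thesis by simp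
  next
    case False
    then have "\<not> M \<subseteq> avoiding E {v}"
      using M by (auto simp: matchings_def)
    then obtain e where e: "e \<in> M" "v \<in> e" "e \<in> E"
      using M by (auto simp: matchings_def avoiding_def)
    \<comment> \<open>No other edge at \<open>v\<close> lies in \<open>M\<close>, since it would
      meet \<open>e\<close> in \<open>v\<close>.\<close>
    have "(\<Sum>f\<in>{e\<in>E. v \<in> e}. of_bool (f \<in> M) * F M)
        = (\<Sum>f\<in>{e\<in>E. v \<in> e}. if f = e then F M else 0)"
      using M e by (intro sum.cong refl) (force simp: matchings_def)
    also have "\<dots> = F M" using e fin by simp
    finally show ?thesis using False by simp
  qed
  have "(\<Sum>M\<in>matchings E. F M)
      = (\<Sum>M\<in>matchings E. of_bool (M \<in> matchings (avoiding E {v})) * F M)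
      + (\<Sum>M\<in>matchings E. \<Sum>e\<in>{e\<in>E. v \<in> e}. of_bool (e \<in> M) * F M)"
    unfolding sum.distrib[symmetric] by (rule sum.cong[OF refl split])
  also have "(\<Sum>M\<in>matchings E. of_bool (M \<in> matchings (avoiding E {v})) * F M)
      = (\<Sum>M\<in>matchings (avoiding E {v}). F M)"
    by (rule sum.mono_neutral_cong_right)
      (use fin matchings_mono[of "avoiding E {v}" E] in \<open>auto simp: finite_matchings avoiding_def\<close>)
  also have "(\<Sum>M\<in>matchings E. \<Sum>e\<in>{e\<in>E. v \<in> e}. of_bool (e \<in> M) * F M)
      = (\<Sum>e\<in>{e\<in>E. v \<in> e}. \<Sum>M\<in>matchings E. of_bool (e \<in> M) * F M)"
    by (rule sum.swap)
  also have "\<dots> = (\<Sum>e\<in>{e\<in>E. v \<in> e}. \<Sum>M\<in>matchings (avoiding E e). F (insert e M))"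
    by (intro sum.cong sum_matchings_containing) (use fin in auto)
  finally show ?thesis .
qed

section \<open>Marginals and covariances through partition functions of subgraphs\<close>

lemma partition_function_times_marginal:
  assumes "finite E"
  shows "partition_function E w * edge_marginal E w f
    = (\<Sum>M\<in>matchings E. of_bool (f \<in> M) * matching_weight w M)"
  using partition_function_pos[OF assms, of w]
  by (simp add: edge_marginal_def matching_measure_eq sum_distrib_left)

text \<open>Given that \<open>e\<close> is present, the rest of the matching is distributed as a
  matching of the graph without the endpoints of \<open>e\<close>. The term
  \<open>of_bool (f = e)\<close> accounts for \<open>e\<close> itself, whose marginal in that graph
  is 0.\<close>

lemma sum_insert_matching_weight:
  assumes "finite E" "e \<noteq> {}"
  shows "(\<Sum>M\<in>matchings (avoiding E e). of_bool (f \<in> insert e M) * matching_weight w (insert e M))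
    = exp (w e) * partition_function (avoiding E e) w
        * (of_bool (f = e) + edge_marginal (avoiding E e) w f)"
proof -
  have "(\<Sum>M\<in>matchings (avoiding E e). of_bool (f \<in> insert e M) * matching_weight w (insert e M))
     = (\<Sum>M\<in>matchings (avoiding E e). exp (w e) * (of_bool (f = e) * matching_weight w M
          + of_bool (f \<in> M) * matching_weight w M))"
    using notin_matchings_avoiding[OF assms(2)] finite_matching[OF finite_avoiding[OF assms(1)]]
    by (intro sum.cong) (auto simp: matching_weight_insert)
  also have "\<dots> = exp (w e) * (of_bool (f = e) * partition_function (avoiding E e) w
      + partition_function (avoiding E e) w * edge_marginal (avoiding E e) w f)"
    using partition_function_times_marginal[OF finite_avoiding[OF assms(1)], of e w f]
    by (simp add: sum_distrib_left sum.distrib partition_function_eq distrib_left)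
  finally show ?thesis by (simp add: algebra_simps)
qed

text \<open>For \<open>e \<in> E\<close> this is the marginal of \<open>e\<close>. As an explicit
  ratio it can be estimated by comparing partition functions of subgraphs.\<close>

definition edge_prob :: "'v set set \<Rightarrow> ('v set \<Rightarrow> real) \<Rightarrow> 'v set \<Rightarrow> real" where
  "edge_prob E w e = exp (w e) * partition_function (avoiding E e) w / partition_function E w"

lemma edge_prob_nonneg: "finite E \<Longrightarrow> edge_prob E w e \<ge> 0"
  using partition_function_pos[of E w] partition_function_pos[OF finite_avoiding, of E e w]
  by (simp add: edge_prob_def)

lemma sum_insert_matching_weight_total:
  assumes "finite E" "e \<noteq> {}"
  shows "(\<Sum>M\<in>matchings (avoiding E e). matching_weight w (insert e M))
    = exp (w e) * partition_function (avoiding E e) w"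
  unfolding partition_function_eq sum_distrib_left
  using notin_matchings_avoiding[OF assms(2)] finite_matching[OF finite_avoiding[OF assms(1)]]
  by (intro sum.cong) (auto simp: matching_weight_insert)

lemma edge_marginal_eq:
  assumes "finite E" "e \<in> E" "e \<noteq> {}"
  shows "edge_marginal E w e = edge_prob E w e"
  using sum_matchings_containing[OF assms, of "matching_weight w"]
    sum_insert_matching_weight_total[OF assms(1,3), of w] partition_function_pos[OF assms(1), of w]
    partition_function_times_marginal[OF assms(1), of w e]
  by (simp add: edge_prob_def field_simps)

text \<open>The covariance is P(e) (P(f | e) - P(f)), and conditioning on \<open>e\<close> amounts
  to deleting its endpoints. Covariances thus become effects of vertex deletions on
  marginals.\<close>

lemma edge_covariance_eq:
  assumes "finite E" "e \<in> E" "e \<noteq> {}"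
  shows "edge_covariance E w e f
    = edge_prob E w e * (of_bool (f = e) + edge_marginal (avoiding E e) w f - edge_marginal E w f)"
proof -
  have "(\<Sum>M\<in>matchings E. of_bool (e \<in> M) * of_bool (f \<in> M) * matching_measure E w M)
     = (\<Sum>M\<in>matchings E. of_bool (e \<in> M) * (of_bool (f \<in> M) * matching_weight w M))
       / partition_function E w"
    by (simp add: matching_measure_eq sum_divide_distrib mult.assoc)
  also have "\<dots> = edge_prob E w e * (of_bool (f = e) + edge_marginal (avoiding E e) w f)"
    unfolding sum_matchings_containing[OF assms] sum_insert_matching_weight[OF assms(1,3)]
      edge_prob_def by simp
  finally show ?thesis
    by (simp add: edge_covariance_def edge_marginal_eq[OF assms] algebra_simps)
qed

text \<open>The first term is the probability that \<open>v\<close> is uncovered, the sum is the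
  probability that it is covered.\<close>

lemma sum_edge_prob_at_vertex:
  assumes "finite E"
  shows "partition_function (avoiding E {v}) w / partition_function E w
    + (\<Sum>e\<in>{e\<in>E. v \<in> e}. edge_prob E w e) = 1"
proof -
  have "partition_function E w = partition_function (avoiding E {v}) w
      + (\<Sum>e\<in>{e\<in>E. v \<in> e}. exp (w e) * partition_function (avoiding E e) w)"
    unfolding partition_function_eq[of E] sum_matchings_split_vertex[OF assms, of _ v]
    unfolding partition_function_eq[of "avoiding E {v}"]
    by (intro arg_cong2[of _ _ _ _ "(+)"] refl sum.cong sum_insert_matching_weight_total assms) auto
  then show ?thesis
    using partition_function_pos[OF assms, of w]
    by (simp add: edge_prob_def sum_divide_distrib[symmetric] add_divide_distrib[symmetric])
qed

text \<open>Law of total probability over the status of \<open>v\<close>: uncovered, or covered by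
  exactly one edge \<open>e\<close>.\<close>

lemma edge_marginal_split_vertex:
  assumes "finite E"
  shows "edge_marginal E w f
    = partition_function (avoiding E {v}) w / partition_function E w * edge_marginal (avoiding E {v}) w f
    + (\<Sum>e\<in>{e\<in>E. v \<in> e}. edge_prob E w e * (of_bool (f = e) + edge_marginal (avoiding E e) w f))"
proof -
  have "partition_function E w * edge_marginal E w f
     = partition_function (avoiding E {v}) w * edge_marginal (avoiding E {v}) w f
      + (\<Sum>e\<in>{e\<in>E. v \<in> e}. exp (w e) * partition_function (avoiding E e) w
        * (of_bool (f = e) + edge_marginal (avoiding E e) w f))"
    unfolding partition_function_times_marginal[OF assms]
      partition_function_times_marginal[OF finite_avoiding[OF assms]]
      sum_matchings_split_vertex[OF assms, of _ v]
    by (intro arg_cong2[of _ _ _ _ "(+)"] refl sum.cong sum_insert_matching_weight assms) auto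
  then show ?thesis
    using partition_function_pos[OF assms, of w]
    by (simp add: edge_prob_def sum_divide_distrib[symmetric] add_divide_distrib[symmetric] field_simps)
qed

text \<open>Strong induction on the number of edges. For an edge \<open>e = {u, v}\<close>, passing
  from \<open>avoiding E {v}\<close> to \<open>avoiding E e\<close> deletes the single vertex
  \<open>u\<close> from a smaller graph. The index set \<open>F\<close> is independent of
  \<open>E\<close>, so the induction hypothesis speaks of a sum over the same edges.\<close>

lemma total_vertex_influence_le:
  assumes "finite E" "\<And>e. e \<in> E \<Longrightarrow> card e = 2"
    "\<And>u. (\<Sum>e\<in>{e\<in>E. u \<in> e}. exp (w e)) \<le> B"
  shows "(\<Sum>f\<in>F. \<bar>edge_marginal (avoiding E {v}) w f - edge_marginal E w f\<bar>) \<le> B"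
  using assms
proof (induction "card E" arbitrary: E v rule: less_induct)
  case less
  note fin = less.prems(1)
  let ?E = "avoiding E {v}" and ?N = "{e\<in>E. v \<in> e}"
  let ?R = "partition_function ?E w / partition_function E w"
  have "0 \<le> (\<Sum>e\<in>?N. exp (w e))" by (intro sum_nonneg) simp
  with less.prems(3)[of v] have B: "0 \<le> B" by linarith
  show ?case
  proof (cases "?N = {}")
    case True
    then have "?E = E" by (auto simp: avoiding_def)
    then show ?thesis using B by simp
  next
    case False
    have card: "card ?E < card E"
      using False fin by (intro psubset_card_mono) (auto simp: avoiding_def)
    have IH: "(\<Sum>f\<in>F. \<bar>edge_marginal (avoiding E e) w f - edge_marginal ?E w f\<bar>) \<le> B"
      if "e \<in> ?N" for e
    proof -
      have "card e = 2" "v \<in> e" using that less.prems(2) by auto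
      then have "\<exists>u. e = {u, v}" by (auto simp: card_2_iff insert_commute)
      then obtain u where u: "e = {u, v}" ..
      then have "avoiding E e = avoiding ?E {u}" by (simp add: avoiding_avoiding insert_commute)
      moreover have "(\<Sum>f\<in>F. \<bar>edge_marginal (avoiding ?E {u}) w f - edge_marginal ?E w f\<bar>) \<le> B"
      proof (rule less.hyps[OF card finite_avoiding[OF fin]])
        show "card e = 2" if "e \<in> ?E" for e
          using that less.prems(2) by (auto simp: avoiding_def)
        show "(\<Sum>e\<in>{e \<in> ?E. x \<in> e}. exp (w e)) \<le> B" for x
        proof (rule order_trans[OF _ less.prems(3)[of x]])
          show "(\<Sum>e\<in>{e \<in> ?E. x \<in> e}. exp (w e)) \<le> (\<Sum>e\<in>{e \<in> E. x \<in> e}. exp (w e))"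
            by (rule sum_mono2) (use fin in \<open>auto simp: avoiding_def\<close>)
        qed
      qed
      ultimately show ?thesis by simp
    qed
    define Q where "Q = (\<Sum>e\<in>?N. edge_prob E w e)"
    have RQ: "?R + Q = 1"
      unfolding Q_def by (rule sum_edge_prob_at_vertex[OF fin])
    then have R: "?R = 1 - Q" by simp
    \<comment> \<open>The odds of \<open>v\<close> being covered are at most \<open>B\<close>:
      removing the edge \<open>e\<close> at \<open>v\<close> from a matching costs the factor
      \<open>exp (w e)\<close> and leaves a matching that avoids \<open>v\<close>.\<close>
    have Q: "Q \<le> B * ?R"
    proof -
      have "edge_prob E w e \<le> exp (w e) * ?R" if "e \<in> ?N" for e
      proof -
        have "partition_function (avoiding E e) w \<le> partition_function ?E w"
          using that by (intro partition_function_mono finite_avoiding fin) (auto simp: avoiding_def)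
        then show ?thesis
          using partition_function_pos[OF fin, of w]
          by (simp add: edge_prob_def divide_right_mono)
      qed
      then have "Q \<le> (\<Sum>e\<in>?N. exp (w e)) * ?R"
        unfolding Q_def sum_distrib_right by (rule sum_mono)
      also have "\<dots> \<le> B * ?R"
        using less.prems(3)[of v] partition_function_pos[OF fin, of w]
          partition_function_pos[OF finite_avoiding[OF fin], of "{v}" w]
        by (intro mult_right_mono) auto
      finally show ?thesis .
    qed
    \<comment> \<open>The split at \<open>v\<close>, with \<open>1 - Q\<close> as the probability
      that \<open>v\<close> is uncovered, expresses the effect of deleting \<open>v\<close> by the
      effects of deleting a neighbour from the graph without \<open>v\<close>, and by the indicator
      of the covering edge.\<close>
    have diff: "edge_marginal ?E w f - edge_marginal E w f
      = (\<Sum>e\<in>?N. edge_prob E w e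
          * (edge_marginal ?E w f - edge_marginal (avoiding E e) w f - of_bool (f = e)))" for f
    proof -
      have "edge_marginal ?E w f - edge_marginal E w f = Q * edge_marginal ?E w f
        - (\<Sum>e\<in>?N. edge_prob E w e * (of_bool (f = e) + edge_marginal (avoiding E e) w f))"
        unfolding edge_marginal_split_vertex[OF fin, of w f v] R
        by (simp only: left_diff_distrib)
      also have "\<dots> = (\<Sum>e\<in>?N. edge_prob E w e
          * (edge_marginal ?E w f - edge_marginal (avoiding E e) w f - of_bool (f = e)))"
        unfolding Q_def sum_distrib_right sum_subtractf[symmetric]
        by (intro sum.cong) (auto simp: algebra_simps)
      finally show ?thesis .
    qed
    have "(\<Sum>f\<in>F. \<bar>edge_marginal ?E w f - edge_marginal E w f\<bar>)
      \<le> (\<Sum>f\<in>F. \<Sum>e\<in>?N. edge_prob E w e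
          * (\<bar>edge_marginal (avoiding E e) w f - edge_marginal ?E w f\<bar> + of_bool (f = e)))"
      unfolding diff
    proof (intro sum_mono order_trans[OF sum_abs])
      fix f e
      show "\<bar>edge_prob E w e
          * (edge_marginal ?E w f - edge_marginal (avoiding E e) w f - of_bool (f = e))\<bar>
        \<le> edge_prob E w e
          * (\<bar>edge_marginal (avoiding E e) w f - edge_marginal ?E w f\<bar> + of_bool (f = e))"
        unfolding abs_mult using edge_prob_nonneg[OF fin, of w e]
        by (simp add: mult_left_mono)
    qed
    also have "\<dots> = (\<Sum>e\<in>?N. edge_prob E w e
          * ((\<Sum>f\<in>F. \<bar>edge_marginal (avoiding E e) w f - edge_marginal ?E w f\<bar>)
             + (\<Sum>f\<in>F. of_bool (f = e))))"
      by (subst sum.swap) (simp only: sum_distrib_left[symmetric] sum.distrib)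
    also have "\<dots> \<le> (\<Sum>e\<in>?N. edge_prob E w e * (B + 1))"
    proof (intro sum_mono mult_left_mono add_mono IH edge_prob_nonneg fin)
      show "(\<Sum>f\<in>F. of_bool (f = e)) \<le> (1::real)" for e
        \<comment> \<open>A sum over an infinite \<open>F\<close> is 0 by convention.\<close>
        by (cases "finite F") (auto simp: of_bool_def)
    qed
    also have "\<dots> = Q * B + Q" by (simp add: Q_def sum_distrib_right distrib_left sum.distrib)
    \<comment> \<open>Here the induction closes: \<open>B\<close> is the fixed point of the
      recursion that sends T to B / (1 + B) * (T + 1).\<close>
    also have "\<dots> \<le> Q * B + B * ?R" using Q by simp
    also have "\<dots> = B * (?R + Q)" by (simp only: distrib_left) (simp add: mult.commute)
    finally show ?thesis unfolding RQ by simp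
  qed
qed

text \<open>Deleting the two endpoints of \<open>e\<close> one after the other changes the marginals
  by at most \<open>B\<close> in total each time. The summand 1 is the contribution of
  \<open>f = e\<close>, and the factor \<open>edge_prob E w e\<close> is bounded by 1.\<close>

lemma total_edge_covariance_le:
  assumes fin: "finite E" and card: "\<And>e. e \<in> E \<Longrightarrow> card e = 2"
    and B: "\<And>u. (\<Sum>e\<in>{e\<in>E. u \<in> e}. exp (w e)) \<le> B" and e: "e \<in> E"
  shows "(\<Sum>f\<in>E. \<bar>edge_covariance E w e f\<bar>) \<le> 1 + 2 * B"
proof -
  obtain u v where uv: "e = {u, v}"
    using card[OF e] by (auto simp: card_2_iff)
  then have ne: "e \<noteq> {}" by auto
  let ?E = "avoiding E {u}"
  have av: "avoiding E e = avoiding ?E {v}" by (simp add: avoiding_avoiding uv insert_commute)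
  have B0: "0 \<le> B"
    using B[of u] sum_nonneg[of "{e\<in>E. u \<in> e}" "\<lambda>e. exp (w e)"] by simp
  have "edge_prob E w e \<le> (\<Sum>e\<in>{e\<in>E. u \<in> e}. edge_prob E w e)"
    using e fin uv by (intro member_le_sum edge_prob_nonneg) auto
  then have p1: "edge_prob E w e \<le> 1"
    using sum_edge_prob_at_vertex[OF fin, of u w]
      partition_function_pos[OF fin, of w] partition_function_pos[OF finite_avoiding[OF fin], of "{u}" w]
    by (smt (verit) divide_nonneg_pos)
  have 1: "(\<Sum>f\<in>E. \<bar>edge_marginal ?E w f - edge_marginal E w f\<bar>) \<le> B"
    by (rule total_vertex_influence_le[OF fin card B])
  have 2: "(\<Sum>f\<in>E. \<bar>edge_marginal (avoiding ?E {v}) w f - edge_marginal ?E w f\<bar>) \<le> B"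
  proof (rule total_vertex_influence_le[OF finite_avoiding[OF fin]])
    show "card e = 2" if "e \<in> ?E" for e using that card by (auto simp: avoiding_def)
    show "(\<Sum>e\<in>{e \<in> ?E. x \<in> e}. exp (w e)) \<le> B" for x
      by (rule order_trans[OF sum_mono2 B[of x]]) (use fin in \<open>auto simp: avoiding_def\<close>)
  qed
  have "(\<Sum>f\<in>E. \<bar>edge_covariance E w e f\<bar>)
    \<le> (\<Sum>f\<in>E. of_bool (f = e) + \<bar>edge_marginal ?E w f - edge_marginal E w f\<bar>
         + \<bar>edge_marginal (avoiding ?E {v}) w f - edge_marginal ?E w f\<bar>)"
  proof (rule sum_mono)
    fix f
    have "\<bar>edge_covariance E w e f\<bar>
      \<le> 1 * \<bar>of_bool (f = e) + edge_marginal (avoiding E e) w f - edge_marginal E w f\<bar>"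
      unfolding edge_covariance_eq[OF fin e ne] abs_mult
      using p1 edge_prob_nonneg[OF fin, of w e] by (intro mult_right_mono) auto
    then show "\<bar>edge_covariance E w e f\<bar>
      \<le> of_bool (f = e) + \<bar>edge_marginal ?E w f - edge_marginal E w f\<bar>
         + \<bar>edge_marginal (avoiding ?E {v}) w f - edge_marginal ?E w f\<bar>"
      unfolding av by (simp add: of_bool_def split: if_splits)
  qed
  also have "\<dots> \<le> 1 + B + B"
    unfolding sum.distrib using 1 2 e fin by (intro add_mono) (auto simp: of_bool_def)
  finally show ?thesis by simp
qed

text \<open>Schur test: since the covariance matrix is symmetric, the inequality between arithmetic
  and geometric mean for the products \<open>\<delta> e * \<delta> f\<close> bounds the quadratic
  form by the absolute row sums.\<close>

lemma sum_edge_covariance_le: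
  assumes fin: "finite E" and card: "\<And>e. e \<in> E \<Longrightarrow> card e = 2"
    and B: "\<And>u. (\<Sum>e\<in>{e\<in>E. u \<in> e}. exp (w e)) \<le> B"
  shows "(\<Sum>e\<in>E. \<Sum>f\<in>E. \<delta> e * \<delta> f * edge_covariance E w e f) \<le> (1 + 2 * B) * (\<Sum>e\<in>E. (\<delta> e)\<^sup>2)"
proof -
  let ?c = "\<lambda>e f. \<bar>edge_covariance E w e f\<bar>"
  have sym: "edge_covariance E w e f = edge_covariance E w f e" for e f
    by (simp add: edge_covariance_def mult.commute)
  have row: "(\<Sum>e\<in>E. \<Sum>f\<in>E. (\<delta> e)\<^sup>2 * ?c e f) \<le> (1 + 2 * B) * (\<Sum>e\<in>E. (\<delta> e)\<^sup>2)"
  proof -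
    have "(\<Sum>e\<in>E. \<Sum>f\<in>E. (\<delta> e)\<^sup>2 * ?c e f) \<le> (\<Sum>e\<in>E. (\<delta> e)\<^sup>2 * (1 + 2 * B))"
      unfolding sum_distrib_left[symmetric]
      by (intro sum_mono mult_left_mono total_edge_covariance_le fin card B) auto
    then show ?thesis by (simp add: sum_distrib_left mult.commute)
  qed
  have "(\<Sum>e\<in>E. \<Sum>f\<in>E. \<delta> e * \<delta> f * edge_covariance E w e f)
    \<le> (\<Sum>e\<in>E. \<Sum>f\<in>E. ((\<delta> e)\<^sup>2 * ?c e f + (\<delta> f)\<^sup>2 * ?c e f) / 2)"
  proof (intro sum_mono)
    fix e f
    have "2 * \<bar>\<delta> e * \<delta> f\<bar> \<le> (\<delta> e)\<^sup>2 + (\<delta> f)\<^sup>2"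
      using sum_squares_bound[of "\<bar>\<delta> e\<bar>" "\<bar>\<delta> f\<bar>"] by (simp add: abs_mult)
    then have "2 * \<bar>\<delta> e * \<delta> f\<bar> * ?c e f \<le> ((\<delta> e)\<^sup>2 + (\<delta> f)\<^sup>2) * ?c e f"
      by (rule mult_right_mono) simp
    moreover have "\<delta> e * \<delta> f * edge_covariance E w e f \<le> \<bar>\<delta> e * \<delta> f\<bar> * ?c e f"
      by (metis abs_ge_self abs_mult)
    ultimately show "\<delta> e * \<delta> f * edge_covariance E w e f
      \<le> ((\<delta> e)\<^sup>2 * ?c e f + (\<delta> f)\<^sup>2 * ?c e f) / 2"
      by (simp add: algebra_simps)
  qed
  also have "\<dots> = ((\<Sum>e\<in>E. \<Sum>f\<in>E. (\<delta> e)\<^sup>2 * ?c e f) + (\<Sum>e\<in>E. \<Sum>f\<in>E. (\<delta> f)\<^sup>2 * ?c e f)) / 2"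
    by (simp add: sum_divide_distrib[symmetric] sum.distrib)
  also have "(\<Sum>e\<in>E. \<Sum>f\<in>E. (\<delta> f)\<^sup>2 * ?c e f) = (\<Sum>e\<in>E. \<Sum>f\<in>E. (\<delta> e)\<^sup>2 * ?c e f)"
    by (subst sum.swap) (simp add: sym)
  finally show ?thesis using row by simp
qed

text \<open>The sum of \<open>\<delta>\<close> over a random matching is a linear combination of the
  edge indicators over all of \<open>E\<close>, so its variance expands by bilinearity.\<close>

lemma variance_eq_sum_edge_covariance:
  assumes fin: "finite E"
  shows "(\<Sum>M\<in>matchings E. (\<Sum>e\<in>M. \<delta> e)\<^sup>2 * matching_measure E w M)
      - (\<Sum>M\<in>matchings E. (\<Sum>e\<in>M. \<delta> e) * matching_measure E w M)\<^sup>2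
    = (\<Sum>e\<in>E. \<Sum>f\<in>E. \<delta> e * \<delta> f * edge_covariance E w e f)"
proof -
  let ?\<mu> = "matching_measure E w" and ?m = "edge_marginal E w"
  let ?J = "\<lambda>e f. \<Sum>M\<in>matchings E. of_bool (e \<in> M) * of_bool (f \<in> M) * ?\<mu> M"
  have S: "(\<Sum>e\<in>M. \<delta> e) = (\<Sum>e\<in>E. \<delta> e * of_bool (e \<in> M))" if "M \<in> matchings E" for M
    by (rule sum.mono_neutral_cong_left) (use that fin in \<open>auto simp: matchings_def\<close>)
  have "(\<Sum>M\<in>matchings E. (\<Sum>e\<in>M. \<delta> e) * ?\<mu> M)
      = (\<Sum>M\<in>matchings E. \<Sum>e\<in>E. \<delta> e * (of_bool (e \<in> M) * ?\<mu> M))"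
    by (intro sum.cong refl) (simp add: S sum_distrib_right mult.assoc)
  also have "\<dots> = (\<Sum>e\<in>E. \<delta> e * ?m e)"
    by (subst sum.swap) (simp only: edge_marginal_def sum_distrib_left)
  finally have mean: "(\<Sum>M\<in>matchings E. (\<Sum>e\<in>M. \<delta> e) * ?\<mu> M) = (\<Sum>e\<in>E. \<delta> e * ?m e)" .
  have "(\<Sum>M\<in>matchings E. (\<Sum>e\<in>M. \<delta> e)\<^sup>2 * ?\<mu> M)
      = (\<Sum>M\<in>matchings E. \<Sum>e\<in>E. \<Sum>f\<in>E. \<delta> e * \<delta> f * (of_bool (e \<in> M) * of_bool (f \<in> M) * ?\<mu> M))"
  proof (intro sum.cong refl)
    fix M assume "M \<in> matchings E"
    then have "(\<Sum>e\<in>M. \<delta> e)\<^sup>2 * ?\<mu> M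
      = (\<Sum>e\<in>E. \<Sum>f\<in>E. (\<delta> e * of_bool (e \<in> M)) * (\<delta> f * of_bool (f \<in> M))) * ?\<mu> M"
      by (simp only: S power2_eq_square sum_product)
    then show "(\<Sum>e\<in>M. \<delta> e)\<^sup>2 * ?\<mu> M
      = (\<Sum>e\<in>E. \<Sum>f\<in>E. \<delta> e * \<delta> f * (of_bool (e \<in> M) * of_bool (f \<in> M) * ?\<mu> M))"
      by (simp only: sum_distrib_right sum_distrib_left mult_ac)
  qed
  also have "\<dots> = (\<Sum>e\<in>E. \<Sum>M\<in>matchings E. \<Sum>f\<in>E. \<delta> e * \<delta> f * (of_bool (e \<in> M) * of_bool (f \<in> M) * ?\<mu> M))"
    by (rule sum.swap)
  also have "\<dots> = (\<Sum>e\<in>E. \<Sum>f\<in>E. \<delta> e * \<delta> f * ?J e f)"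
    by (intro sum.cong refl, subst sum.swap) (simp only: sum_distrib_left)
  finally have sq: "(\<Sum>M\<in>matchings E. (\<Sum>e\<in>M. \<delta> e)\<^sup>2 * ?\<mu> M)
      = (\<Sum>e\<in>E. \<Sum>f\<in>E. \<delta> e * \<delta> f * ?J e f)" .
  show ?thesis
    unfolding mean sq edge_covariance_def
    by (simp only: power2_eq_square sum_product sum_subtractf[symmetric] right_diff_distrib mult_ac)
qed

section \<open>Hellinger distance of matching measures\<close>

text \<open>The second derivative of \<open>ln (Z t)\<close> is the variance of \<open>b\<close>
  under the weights \<open>exp (a x + t * b x)\<close>, hence at most \<open>K\<close>. So
  \<open>K * t\<^sup>2 / 2 - ln (Z t)\<close> is convex on the unit interval, and its midpoint
  inequality leaves \<open>K / 4 - K / 8\<close>.\<close>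

lemma log_sum_exp_midpoint:
  fixes a b :: "'s \<Rightarrow> real" and S :: "'s set"
  defines "Z \<equiv> \<lambda>t. \<Sum>x\<in>S. exp (a x + t * b x)"
    and "Z1 \<equiv> \<lambda>t. \<Sum>x\<in>S. b x * exp (a x + t * b x)"
    and "Z2 \<equiv> \<lambda>t. \<Sum>x\<in>S. (b x)\<^sup>2 * exp (a x + t * b x)"
  assumes fin: "finite S" "S \<noteq> {}"
    and var: "\<And>t. t \<in> {0..1} \<Longrightarrow> Z2 t / Z t - (Z1 t / Z t)\<^sup>2 \<le> K"
  shows "(ln (Z 0) + ln (Z 1)) / 2 - ln (Z (1/2)) \<le> K / 8"
proof -
  have pos: "Z t > 0" for t unfolding Z_def using fin by (intro sum_pos) auto
  have d0: "(Z has_real_derivative Z1 t) (at t)" for t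
    unfolding Z_def Z1_def by (auto intro!: derivative_eq_intros sum.cong)
  have d1: "(Z1 has_real_derivative Z2 t) (at t)" for t
    unfolding Z1_def Z2_def
    by (auto intro!: derivative_eq_intros sum.cong simp: power2_eq_square)
  let ?g = "\<lambda>t. K * t\<^sup>2 / 2 - ln (Z t)"
  have "convex_on {0..1} ?g"
  proof (rule f''_ge0_imp_convex)
    show "(?g has_real_derivative K * t - Z1 t / Z t) (at t)" for t
      using pos[of t] by (auto intro!: derivative_eq_intros d0)
    show "((\<lambda>t. K * t - Z1 t / Z t) has_real_derivative (K - (Z2 t / Z t - (Z1 t / Z t)\<^sup>2))) (at t)" for t
      using pos[of t]
      by (auto intro!: derivative_eq_intros d0 d1 simp: power2_eq_square field_simps)
  qed (use var in auto)
  from convex_onD[OF this, of "1/2" 0 1] show ?thesis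
    by (simp add: field_simps power2_eq_square)
qed

text \<open>The geometric mean of the two mass functions is proportional to the matching weight for
  the averaged edge weights. Summing it gives the affinity as a ratio of partition
  functions.\<close>

lemma hellinger_dist_sq_eq:
  assumes fin: "finite E"
  shows "(hellinger_dist (matchings E) (matching_measure E w') (matching_measure E w))\<^sup>2
    = 2 - 2 * exp (ln (partition_function E (\<lambda>e. (w e + w' e) / 2))
        - (ln (partition_function E w) + ln (partition_function E w')) / 2)"
proof -
  let ?Z = "partition_function E"
  have pos: "?Z u > 0" for u by (rule partition_function_pos[OF fin])
  have sqrt_mul: "sqrt (matching_measure E w' M * matching_measure E w M)
      = matching_weight (\<lambda>e. (w e + w' e) / 2) M * exp (- (ln (?Z w) + ln (?Z w')) / 2)" for M
  proof -
    have "matching_measure E w' M * matching_measure E w M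
      = exp ((\<Sum>e\<in>M. w' e) + (\<Sum>e\<in>M. w e) - ln (?Z w) - ln (?Z w'))"
      using pos[of w] pos[of w'] by (simp add: matching_measure_def exp_diff exp_add)
    also have "\<dots> = (exp (((\<Sum>e\<in>M. w' e) + (\<Sum>e\<in>M. w e) - ln (?Z w) - ln (?Z w')) / 2))\<^sup>2"
      by (simp add: exp_double[symmetric])
    finally have "sqrt (matching_measure E w' M * matching_measure E w M)
        = exp (((\<Sum>e\<in>M. w' e) + (\<Sum>e\<in>M. w e) - ln (?Z w) - ln (?Z w')) / 2)" by simp
    also have "\<dots> = exp ((\<Sum>e\<in>M. (w e + w' e) / 2) + - (ln (?Z w) + ln (?Z w')) / 2)"
      by (simp add: sum_divide_distrib[symmetric] sum.distrib field_simps)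
    finally show ?thesis by (simp only: matching_weight_def exp_add)
  qed
  have "(hellinger_dist (matchings E) (matching_measure E w') (matching_measure E w))\<^sup>2
    = (\<Sum>M\<in>matchings E. (sqrt (matching_measure E w' M) - sqrt (matching_measure E w M))\<^sup>2)"
    unfolding hellinger_dist_def by (intro real_sqrt_pow2 sum_nonneg) simp
  also have "\<dots> = (\<Sum>M\<in>matchings E. matching_measure E w' M + matching_measure E w M
      - 2 * sqrt (matching_measure E w' M * matching_measure E w M))"
    using matching_measure_pos[OF fin, THEN less_imp_le]
    by (intro sum.cong refl) (simp add: power2_diff real_sqrt_mult)
  also have "\<dots> = 2 - 2 * (?Z (\<lambda>e. (w e + w' e) / 2) * exp (- (ln (?Z w) + ln (?Z w')) / 2))"
    by (simp only: sum_subtractf sum.distrib sum_matching_measure[OF fin] sum_distrib_left[symmetric]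
        sqrt_mul sum_distrib_right[symmetric] partition_function_eq[symmetric])
  also have "?Z (\<lambda>e. (w e + w' e) / 2) * exp (- (ln (?Z w) + ln (?Z w')) / 2)
    = exp (ln (?Z (\<lambda>e. (w e + w' e) / 2)) - (ln (?Z w) + ln (?Z w')) / 2)"
    by (subst exp_ln[OF pos[of "\<lambda>e. (w e + w' e) / 2"], symmetric], simp only: exp_add[symmetric])
      (simp add: add_divide_distrib diff_divide_distrib)
  finally show ?thesis .
qed

text \<open>The activity bound is required along the whole segment between \<open>w\<close> and
  \<open>w'\<close>, because the variance has to be controlled at every intermediate weight.\<close>

lemma hellinger_dist_sq_le:
  assumes fin: "finite E" and card: "\<And>e. e \<in> E \<Longrightarrow> card e = 2"
    and B: "\<And>u t. t \<in> {0..1} \<Longrightarrow> (\<Sum>e\<in>{e\<in>E. u \<in> e}. exp (w e + t * (w' e - w e))) \<le> B"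
  shows "(hellinger_dist (matchings E) (matching_measure E w') (matching_measure E w))\<^sup>2
    \<le> (1 + 2 * B) / 4 * (\<Sum>e\<in>E. (w' e - w e)\<^sup>2)"
proof -
  let ?Z = "partition_function E"
  define \<delta> where "\<delta> e = w' e - w e" for e
  define wt where "wt t e = w e + t * \<delta> e" for t e
  define K where "K = (1 + 2 * B) * (\<Sum>e\<in>E. (\<delta> e)\<^sup>2)"
  define b where "b M = (\<Sum>e\<in>M. \<delta> e)" for M :: "'a set set"
  have wt: "exp ((\<Sum>e\<in>M. w e) + t * b M) = matching_weight (wt t) M" for t M
    by (simp add: matching_weight_def wt_def b_def sum.distrib sum_distrib_left)
  have "(ln (\<Sum>M\<in>matchings E. exp ((\<Sum>e\<in>M. w e) + 0 * b M))
      + ln (\<Sum>M\<in>matchings E. exp ((\<Sum>e\<in>M. w e) + 1 * b M))) / 2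
      - ln (\<Sum>M\<in>matchings E. exp ((\<Sum>e\<in>M. w e) + (1/2) * b M)) \<le> K / 8"
  proof (rule log_sum_exp_midpoint)
    fix t :: real assume t: "t \<in> {0..1}"
    have "(\<Sum>M\<in>matchings E. (b M)\<^sup>2 * matching_measure E (wt t) M)
      - (\<Sum>M\<in>matchings E. b M * matching_measure E (wt t) M)\<^sup>2 \<le> K"
      unfolding b_def variance_eq_sum_edge_covariance[OF fin] K_def
      using B[OF t] by (intro sum_edge_covariance_le fin card) (auto simp: wt_def \<delta>_def)
    then show "(\<Sum>M\<in>matchings E. (b M)\<^sup>2 * exp ((\<Sum>e\<in>M. w e) + t * b M))
        / (\<Sum>M\<in>matchings E. exp ((\<Sum>e\<in>M. w e) + t * b M))
      - ((\<Sum>M\<in>matchings E. b M * exp ((\<Sum>e\<in>M. w e) + t * b M))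
        / (\<Sum>M\<in>matchings E. exp ((\<Sum>e\<in>M. w e) + t * b M)))\<^sup>2 \<le> K"
      unfolding wt by (simp add: matching_measure_eq partition_function_eq sum_divide_distrib)
  qed (use finite_matchings[OF fin] empty_in_matchings in auto)
  moreover have "wt 0 = w" "wt 1 = w'" "wt (1/2) = (\<lambda>e. (w e + w' e) / 2)"
    by (auto simp: wt_def \<delta>_def field_simps)
  ultimately have "(ln (?Z w) + ln (?Z w')) / 2 - ln (?Z (\<lambda>e. (w e + w' e) / 2)) \<le> K / 8"
    unfolding wt partition_function_eq[symmetric] by simp
  moreover have "(1 + 2 * B) / 4 * (\<Sum>e\<in>E. (w' e - w e)\<^sup>2) = K / 4"
    by (simp add: K_def \<delta>_def)
  \<comment> \<open>With 1 + x \<le> exp x, a midpoint defect of at most \<open>K / 8\<close> gives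
    \<open>2 - 2 * exp (- K / 8) \<le> K / 4\<close>.\<close>
  ultimately show ?thesis
    unfolding hellinger_dist_sq_eq[OF fin]
    using exp_ge_add_one_self[of "ln (?Z (\<lambda>e. (w e + w' e) / 2)) - (ln (?Z w) + ln (?Z w')) / 2"]
    by linarith
qed

section \<open>Modified weights\<close>

lemma logistic_bounds: "0 < logistic t" "logistic t < 1"
  by (auto simp: logistic_def field_simps add_pos_pos)

lemma logistic_minus: "logistic (- t) = 1 - logistic t"
proof -
  have "0 < 1 + exp t" by (simp add: add_pos_pos)
  then show ?thesis by (simp add: logistic_def exp_minus divide_simps)
qed

lemma logistic_mono: "s \<le> t \<Longrightarrow> logistic s \<le> logistic t"
  by (simp add: logistic_def field_simps add_pos_pos)

lemma logit_logistic: "logit (logistic t) = t"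
proof -
  have "0 < 1 + exp t" by (simp add: add_pos_pos)
  then have "logistic t / (1 - logistic t) = exp t"
    by (simp add: logistic_def divide_simps)
  then show ?thesis by (simp add: logit_def)
qed

lemma exp_logit: "0 < p \<Longrightarrow> p < 1 \<Longrightarrow> exp (logit p) = p / (1 - p)"
  by (simp add: logit_def)

lemma has_real_derivative_logistic:
  "(logistic has_real_derivative logistic t * (1 - logistic t)) (at t)"
proof -
  have "1 + exp t > 0" by (simp add: add_pos_pos)
  then show ?thesis
    unfolding logistic_def [abs_def]
    by (auto intro!: derivative_eq_intros simp: divide_simps) (simp add: algebra_simps)
qed

text \<open>With p the value of \<open>logistic\<close>, its second derivative is p (1 - p) (1 - 2
  p), of absolute value at most 1. The Lagrange remainder is therefore bounded uniformly in
  \<open>w\<close>.\<close>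

lemma logistic_taylor:
  "\<bar>logistic (w + x) - logistic w - logistic w * (1 - logistic w) * x\<bar> \<le> x\<^sup>2"
proof -
  let ?d1 = "\<lambda>t. logistic (w + t) * (1 - logistic (w + t))"
  let ?d2 = "\<lambda>t. logistic (w + t) * (1 - logistic (w + t)) * (1 - 2 * logistic (w + t))"
  \<comment> \<open>The expansion differentiates only the orders 0 and 1, so the family may be
    constant from order 2 on.\<close>
  let ?d = "\<lambda>m::nat. if m = 0 then \<lambda>t. logistic (w + t) else if m = 1 then ?d1 else ?d2"
  have D0: "((\<lambda>t. logistic (w + t)) has_real_derivative ?d1 t) (at t)" for t
  proof -
    have "((\<lambda>t. w + t) has_real_derivative 1) (at t)" by (auto intro!: derivative_eq_intros)
    from DERIV_chain2[OF has_real_derivative_logistic this] show ?thesis by simp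
  qed
  have D1: "(?d1 has_real_derivative ?d2 t) (at t)" for t
    by (rule DERIV_cong[OF DERIV_mult[OF D0 DERIV_diff[OF DERIV_const D0]]])
      (simp add: algebra_simps)
  have "\<forall>m t. m < 2 \<and> \<bar>t\<bar> \<le> \<bar>x\<bar> \<longrightarrow> (?d m has_real_derivative ?d (Suc m) t) (at t)"
  proof (intro allI impI)
    fix m :: nat and t :: real assume "m < 2 \<and> \<bar>t\<bar> \<le> \<bar>x\<bar>"
    then consider "m = 0" | "m = 1" by linarith
    then show "(?d m has_real_derivative ?d (Suc m) t) (at t)"
      by cases (simp_all add: D0 D1)
  qed
  from Maclaurin_bi_le[of ?d, OF refl this] obtain t
    where t: "logistic (w + x) = logistic w + ?d1 0 * x + ?d2 t / 2 * x\<^sup>2"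
    by (auto simp: numeral_2_eq_2)
  have p: "0 < logistic (w + t)" "logistic (w + t) < 1" by (rule logistic_bounds)+
  then have "\<bar>?d2 t\<bar> \<le> 1 * 1"
    unfolding abs_mult by (intro mult_mono mult_le_one) auto
  then have "\<bar>?d2 t\<bar> / 2 * x ^ 2 \<le> 1 * x ^ 2" by (intro mult_right_mono) auto
  moreover have "logistic (w + x) - logistic w - logistic w * (1 - logistic w) * x = ?d2 t / 2 * x ^ 2"
    using t by simp
  ultimately show ?thesis by (simp only: abs_mult[of _ "x\<^sup>2"]) simp
qed

text \<open>The derivative is \<open>1 / (x * (1 - x))\<close>. Of the two factors one is at least
  1/2 and the other at least \<open>m\<close>, so it is at most \<open>2 / m\<close>.\<close>

lemma logit_lipschitz:
  assumes m: "0 < m" and p: "p \<in> {m..1-m}" "q \<in> {m..1-m}"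
  shows "\<bar>logit p - logit q\<bar> \<le> 2 / m * \<bar>p - q\<bar>"
proof -
  have D: "(logit has_real_derivative 1 / (x * (1 - x))) (at x within {m..1-m})"
    if "x \<in> {m..1-m}" for x
  proof -
    have "0 < x" "x < 1" using that m by auto
    then have "(logit has_real_derivative 1 / (x * (1 - x))) (at x)"
      unfolding logit_def[abs_def]
      by (auto intro!: derivative_eq_intros simp: divide_simps)
    then show ?thesis by (rule has_field_derivative_at_within)
  qed
  have "norm (1 / (x * (1 - x))) \<le> 2 / m" if "x \<in> {m..1-m}" for x
  proof -
    have x: "0 < x" "x < 1" using that m by auto
    have "m / 2 \<le> x * (1 - x)"
    proof (cases "x \<le> 1/2")
      case True
      then have "m * (1/2) \<le> x * (1 - x)" using that m by (intro mult_mono) auto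
      then show ?thesis by simp
    next
      case False
      then have "(1/2) * m \<le> x * (1 - x)" using that m by (intro mult_mono) auto
      then show ?thesis by simp
    qed
    then have "1 / (x * (1 - x)) \<le> 1 / (m / 2)" using m by (intro divide_left_mono) auto
    then show ?thesis using x by simp
  qed
  from field_differentiable_bound[OF _ D this, of p q] p show ?thesis
    by (simp add: abs_minus_commute)
qed

section \<open>Averaging over the noise of a single edge\<close>

context
  fixes P :: "'v set \<Rightarrow> 'a measure" and \<xi> :: "'v set \<Rightarrow> 'a \<Rightarrow> real" and w :: "'v set \<Rightarrow> real" and e
  assumes P: "prob_space (P e)" and meas: "\<xi> e \<in> borel_measurable (P e)"
begin

interpretation prob_space "P e" by (rule P)

lemma logistic_noise_measurable: "(\<lambda>\<omega>. logistic (w e + \<xi> e \<omega>)) \<in> borel_measurable (P e)"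
  using meas unfolding logistic_def by measurable

lemma integrable_logistic_noise: "integrable (P e) (\<lambda>\<omega>. logistic (w e + \<xi> e \<omega>))"
  by (rule integrable_const_bound[where B = 1])
    (auto intro: logistic_noise_measurable less_imp_le logistic_bounds simp: abs_of_pos logistic_bounds)

text \<open>Strict inequalities survive integration over a space of total mass 1. They place the
  modified probability in the range where \<open>logit\<close> inverts the logistic
  function.\<close>

lemma modified_prob_bounds: "0 < modified_prob P \<xi> w e" "modified_prob P \<xi> w e < 1"
proof -
  have "integral\<^sup>L (P e) (\<lambda>_. 0) < modified_prob P \<xi> w e"
    unfolding modified_prob_def
    by (rule integral_less_AE_space) (auto simp: integrable_logistic_noise logistic_bounds emeasure_space_1)
  then show "0 < modified_prob P \<xi> w e" by simp
  have "modified_prob P \<xi> w e < integral\<^sup>L (P e) (\<lambda>_. 1)"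
    unfolding modified_prob_def
    by (rule integral_less_AE_space) (auto simp: integrable_logistic_noise logistic_bounds emeasure_space_1)
  then show "modified_prob P \<xi> w e < 1" by (simp add: prob_space)
qed

text \<open>The linear Taylor term integrates to 0 because the noise is centred, and the remainder
  is bounded by the second moment.\<close>

lemma modified_prob_deviation:
  assumes int: "integrable (P e) (\<lambda>\<omega>. (\<xi> e \<omega>)\<^sup>2)" and mean: "(\<integral>\<omega>. \<xi> e \<omega> \<partial>P e) = 0"
  shows "\<bar>modified_prob P \<xi> w e - logistic (w e)\<bar> \<le> (noise_sd (P e) (\<xi> e))\<^sup>2"
proof -
  let ?l = "logistic (w e)"
  let ?r = "\<lambda>\<omega>. logistic (w e + \<xi> e \<omega>) - ?l - ?l * (1 - ?l) * \<xi> e \<omega>"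
  have i: "integrable (P e) (\<xi> e)"
    by (rule square_integrable_imp_integrable[OF meas int])
  have eq: "modified_prob P \<xi> w e - ?l = (\<integral>\<omega>. ?r \<omega> \<partial>P e)"
    using i integrable_logistic_noise by (simp add: modified_prob_def mean prob_space)
  have "\<bar>modified_prob P \<xi> w e - ?l\<bar> \<le> (\<integral>\<omega>. \<bar>?r \<omega>\<bar> \<partial>P e)"
    unfolding eq by (rule integral_abs_bound)
  also have "\<dots> \<le> (\<integral>\<omega>. (\<xi> e \<omega>)\<^sup>2 \<partial>P e)"
    using i integrable_logistic_noise int by (intro integral_mono logistic_taylor) auto
  finally show ?thesis by (simp add: noise_sd_def)
qed

text \<open>Let 2 m be \<open>logistic (- W)\<close>. The weight bound puts
  \<open>logistic (w e)\<close> between 2 m and 1 - 2 m, and the noise moves it by at most m / 2.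
  Both probabilities thus lie between m and 1 - m, where \<open>logit\<close> has Lipschitz constant
  2 / m.\<close>

lemma modified_weight_deviation:
  assumes int: "integrable (P e) (\<lambda>\<omega>. (\<xi> e \<omega>)\<^sup>2)" and mean: "(\<integral>\<omega>. \<xi> e \<omega> \<partial>P e) = 0"
    and W: "\<bar>w e\<bar> \<le> W" and small: "(noise_sd (P e) (\<xi> e))\<^sup>2 \<le> logistic (- W) / 4"
  shows "\<bar>modified_weight P \<xi> w e - w e\<bar> \<le> 4 / logistic (- W) * (noise_sd (P e) (\<xi> e))\<^sup>2"
proof -
  define m where "m = logistic (- W) / 2"
  have m: "0 < m" unfolding m_def using logistic_bounds(1)[of "- W"] by simp
  have "logistic (- W) \<le> logistic (w e)" "logistic (- W) \<le> logistic (- w e)"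
    using W by (auto intro!: logistic_mono)
  then have l: "logistic (w e) \<in> {2 * m..1 - 2 * m}" by (simp add: m_def logistic_minus field_simps)
  note dev = modified_prob_deviation[OF int mean]
  have "modified_prob P \<xi> w e \<in> {m..1-m}"
    using dev l small m by (simp add: m_def) linarith
  moreover have "logistic (w e) \<in> {m..1-m}" using l m by auto
  ultimately have "\<bar>logit (modified_prob P \<xi> w e) - logit (logistic (w e))\<bar>
      \<le> 2 / m * \<bar>modified_prob P \<xi> w e - logistic (w e)\<bar>"
    by (intro logit_lipschitz m)
  also have "\<dots> \<le> 2 / m * (noise_sd (P e) (\<xi> e))\<^sup>2"
    using dev m by (intro mult_left_mono) auto
  finally show ?thesis by (simp add: modified_weight_def logit_logistic m_def)
qed

end

section \<open>Invariant distribution of the noisy kernel\<close>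

text \<open>Where \<open>r\<close> attains its maximum, the \<open>K\<close>-average of the
  nonnegative gaps to the maximum vanishes, so every point reached with positive probability is a
  maximum too. Following a path to \<open>z\<close> shows that \<open>z\<close> is a
  maximum.\<close>

lemma harmonic_max_principle:
  fixes K :: "'s \<Rightarrow> 's \<Rightarrow> real" and r :: "'s \<Rightarrow> real"
  assumes fin: "finite S"
    and nonneg: "\<And>x y. x \<in> S \<Longrightarrow> y \<in> S \<Longrightarrow> 0 \<le> K x y"
    and stoch: "\<And>x. x \<in> S \<Longrightarrow> (\<Sum>y\<in>S. K x y) = 1"
    and harm: "\<And>x. x \<in> S \<Longrightarrow> (\<Sum>y\<in>S. K x y * r y) = r x"
    and reach: "\<And>x. x \<in> S \<Longrightarrow> (x, z) \<in> {(x, y). x \<in> S \<and> y \<in> S \<and> 0 < K x y}\<^sup>*"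
    and x: "x \<in> S"
  shows "r x \<le> r z"
proof -
  define m where "m = Max (r ` S)"
  have le: "r y \<le> m" if "y \<in> S" for y unfolding m_def using fin that by simp
  have "m \<in> r ` S" unfolding m_def using fin x by (intro Max_in) auto
  then obtain x0 where x0: "x0 \<in> S" "r x0 = m" by auto
  have step: "r b = m" if "r a = m" "a \<in> S" "b \<in> S" "0 < K a b" for a b
  proof -
    have "(\<Sum>y\<in>S. K a y * (m - r y)) = 0"
      using harm[OF that(2)] stoch[OF that(2)] that(1)
      by (simp add: right_diff_distrib sum_subtractf sum_distrib_right[symmetric])
    moreover have "\<forall>y\<in>S. 0 \<le> K a y * (m - r y)"
      using nonneg[OF that(2)] le by simp
    ultimately have "K a b * (m - r b) = 0"
      using fin that(3) by (simp add: sum_nonneg_eq_0_iff)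
    with that show ?thesis by simp
  qed
  from reach[OF x0(1)] have "r z = m"
    by induction (use x0 step in auto)
  then show ?thesis using le[OF x] by simp
qed

text \<open>
  For a reversible kernel, \<open>\<nu>\<close> is invariant iff the ratio \<open>\<nu> / \<mu>\<close> is harmonic, and harmonic
  functions are constant by the maximum principle.
\<close>

lemma invariant_distribution_reversible_iff:
  fixes K :: "'s \<Rightarrow> 's \<Rightarrow> real" and \<mu> \<nu> :: "'s \<Rightarrow> real"
  assumes fin: "finite S"
    and nonneg: "\<And>x y. x \<in> S \<Longrightarrow> y \<in> S \<Longrightarrow> 0 \<le> K x y"
    and stoch: "\<And>x. x \<in> S \<Longrightarrow> (\<Sum>y\<in>S. K x y) = 1"
    and pos: "\<And>x. x \<in> S \<Longrightarrow> 0 < \<mu> x" and total: "(\<Sum>x\<in>S. \<mu> x) = 1"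
    and rev: "\<And>x y. x \<in> S \<Longrightarrow> y \<in> S \<Longrightarrow> \<mu> x * K x y = \<mu> y * K y x"
    and reach: "\<And>x. x \<in> S \<Longrightarrow> (x, z) \<in> {(x, y). x \<in> S \<and> y \<in> S \<and> 0 < K x y}\<^sup>*"
  shows "invariant_distribution S K \<nu> \<longleftrightarrow> (\<forall>x\<in>S. \<nu> x = \<mu> x)"
proof
  assume inv: "invariant_distribution S K \<nu>"
  define r where "r x = \<nu> x / \<mu> x" for x
  have \<nu>: "\<nu> x = r x * \<mu> x" if "x \<in> S" for x
    using pos[OF that] by (simp add: r_def)
  have harm: "(\<Sum>y\<in>S. K x y * r y) = r x" if x: "x \<in> S" for x
  proof -
    have "\<mu> x * (\<Sum>y\<in>S. K x y * r y) = (\<Sum>y\<in>S. \<nu> y * K y x)"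
      unfolding sum_distrib_left
    proof (intro sum.cong refl)
      fix y assume "y \<in> S"
      with rev[OF x this] \<nu> show "\<mu> x * (K x y * r y) = \<nu> y * K y x"
        by (metis mult.assoc mult.commute)
    qed
    also have "\<dots> = \<mu> x * r x"
      using inv x by (simp add: invariant_distribution_def \<nu>)
    finally show ?thesis using pos[OF x] by simp
  qed
  have "r x \<le> r z" if "x \<in> S" for x
    by (rule harmonic_max_principle[OF fin nonneg stoch harm reach that])
  \<comment> \<open>The negative of a harmonic function is harmonic, so the same principle gives the
    reverse inequality.\<close>
  moreover have "- r x \<le> - r z" if "x \<in> S" for x
    by (rule harmonic_max_principle[OF fin nonneg stoch _ reach that])
      (simp_all add: sum_negf harm)
  ultimately have const: "r x = r z" if "x \<in> S" for x using that by force
  have "1 = (\<Sum>x\<in>S. \<nu> x)" using inv by (simp add: invariant_distribution_def)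
  also have "\<dots> = r z" using \<nu> const by (simp add: sum_distrib_left[symmetric] total)
  finally show "\<forall>x\<in>S. \<nu> x = \<mu> x" using \<nu> const by simp
next
  assume eq: "\<forall>x\<in>S. \<nu> x = \<mu> x"
  have "(\<Sum>x\<in>S. \<nu> x * K x y) = \<nu> y" if y: "y \<in> S" for y
  proof -
    have "(\<Sum>x\<in>S. \<nu> x * K x y) = (\<Sum>x\<in>S. \<mu> y * K y x)"
      using eq rev y by (intro sum.cong) auto
    also have "\<dots> = \<nu> y" using stoch[OF y] eq y by (simp add: sum_distrib_left[symmetric])
    finally show ?thesis .
  qed
  then show "invariant_distribution S K \<nu>"
    using eq pos total by (auto simp: invariant_distribution_def less_imp_le)
qed

text \<open>The update at a fixed edge \<open>e\<close> with a deterministic success probability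
  \<open>p\<close>; a blocked \<open>e\<close> is never inserted.\<close>

definition edge_kernel :: "real \<Rightarrow> 'v set \<Rightarrow> 'v set set \<Rightarrow> 'v set set \<Rightarrow> real" where
  "edge_kernel p e M M' = of_bool (edge_free M e) * p * of_bool (insert e M = M')
     + (1 - of_bool (edge_free M e) * p) * of_bool (M - {e} = M')"

lemma pmf_map_bernoulli:
  assumes "0 \<le> p" "p \<le> 1"
  shows "pmf (map_pmf f (bernoulli_pmf p)) y = p * of_bool (f True = y) + (1 - p) * of_bool (f False = y)"
proof -
  have "measure (bernoulli_pmf p) (f -` {y}) = (\<integral>b. indicator (f -` {y}) b \<partial>bernoulli_pmf p)"
    by simp
  also have "\<dots> = indicator (f -` {y}) True * p + indicator (f -` {y}) False * (1 - p)"
    by (rule integral_bernoulli_pmf[OF assms])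
  finally show ?thesis by (auto simp: pmf_map indicator_def)
qed

text \<open>For a fixed edge the transition probability is affine in the success probability, so
  averaging over the fresh noise merely replaces it by its mean
  \<open>modified_prob\<close>.\<close>

lemma noisy_gibbs_kernel_eq:
  assumes "\<And>e. e \<in> E \<Longrightarrow> prob_space (P e) \<and> \<xi> e \<in> borel_measurable (P e)"
  shows "noisy_gibbs_kernel E P \<xi> w M M'
    = (\<Sum>e\<in>E. edge_kernel (modified_prob P \<xi> w e) e M M') / real (card E)"
  unfolding noisy_gibbs_kernel_def
proof (intro arg_cong2[of _ _ _ _ "(/)"] refl sum.cong)
  fix e assume "e \<in> E"
  then interpret prob_space "P e" using assms by auto
  have int: "integrable (P e) (\<lambda>\<omega>. logistic (w e + \<xi> e \<omega>))"
    using assms[OF \<open>e \<in> E\<close>] by (intro integrable_logistic_noise) auto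
  let ?I = "of_bool (edge_free M e) :: real"
  have "(\<integral>\<omega>. pmf (map_pmf (edge_update e M)
        (bernoulli_pmf (?I * logistic (w e + \<xi> e \<omega>)))) M' \<partial>P e)
    = (\<integral>\<omega>. ?I * logistic (w e + \<xi> e \<omega>) * of_bool (insert e M = M')
        + (1 - ?I * logistic (w e + \<xi> e \<omega>)) * of_bool (M - {e} = M') \<partial>P e)"
  proof (rule Bochner_Integration.integral_cong[OF refl])
    fix \<omega>
    have "0 \<le> ?I * logistic (w e + \<xi> e \<omega>)" "?I * logistic (w e + \<xi> e \<omega>) \<le> 1"
      using logistic_bounds[of "w e + \<xi> e \<omega>"] by auto
    then show "pmf (map_pmf (edge_update e M) (bernoulli_pmf (?I * logistic (w e + \<xi> e \<omega>)))) M'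
      = ?I * logistic (w e + \<xi> e \<omega>) * of_bool (insert e M = M')
        + (1 - ?I * logistic (w e + \<xi> e \<omega>)) * of_bool (M - {e} = M')"
      by (subst pmf_map_bernoulli) (auto simp: edge_update_def)
  qed
  also have "\<dots> = edge_kernel (modified_prob P \<xi> w e) e M M'"
    using int by (simp add: edge_kernel_def modified_prob_def prob_space)
  finally show "(\<integral>\<omega>. pmf (map_pmf (edge_update e M)
        (bernoulli_pmf (?I * logistic (w e + \<xi> e \<omega>)))) M' \<partial>P e)
    = edge_kernel (modified_prob P \<xi> w e) e M M'" .
qed

section \<open>Detailed balance and uniqueness of the invariant distribution\<close>

lemma edge_kernel_nonneg: "0 \<le> p \<Longrightarrow> p \<le> 1 \<Longrightarrow> 0 \<le> edge_kernel p e M M'"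
  by (simp add: edge_kernel_def)

lemma edge_free_matching: "M \<in> matchings E \<Longrightarrow> e \<in> M \<Longrightarrow> edge_free M e"
  by (auto simp: matchings_def edge_free_def)

lemma insert_matching: "M \<in> matchings E \<Longrightarrow> e \<in> E \<Longrightarrow> edge_free M e \<Longrightarrow> insert e M \<in> matchings E"
  by (auto simp: matchings_def edge_free_def)

lemma Diff_matching: "M \<in> matchings E \<Longrightarrow> M - A \<in> matchings E"
  by (auto simp: matchings_def)

lemma sum_edge_kernel:
  assumes "finite E" "e \<in> E" "M \<in> matchings E"
  shows "(\<Sum>M'\<in>matchings E. edge_kernel p e M M') = 1"
proof -
  have fin: "finite (matchings E)" by (rule finite_matchings[OF assms(1)])
  have "(\<Sum>M'\<in>matchings E. of_bool (M - {e} = M')) = (1::real)"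
    using Diff_matching[OF assms(3)] fin by (simp add: of_bool_def)
  \<comment> \<open>For a blocked \<open>e\<close> the set \<open>insert e M\<close> need not be a
    matching; the prefactor then makes both sides 0.\<close>
  moreover have "of_bool (edge_free M e) * (\<Sum>M'\<in>matchings E. of_bool (insert e M = M'))
      = (of_bool (edge_free M e) :: real)"
    using insert_matching[OF assms(3,2)] fin by (simp add: of_bool_def)
  ultimately show ?thesis
    unfolding edge_kernel_def sum.distrib sum_distrib_left[symmetric]
    by (auto simp: of_bool_def split: if_splits)
qed

text \<open>The update at \<open>e\<close> exchanges only \<open>N\<close> and
  \<open>insert e N\<close>. Their weights have ratio \<open>exp (w e) = p / (1 - p)\<close>, which
  is exactly the odds of inserting against deleting \<open>e\<close>.\<close>

lemma edge_kernel_reversible: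
  assumes fin: "finite E" and M: "M \<in> matchings E" "M' \<in> matchings E"
    and p: "0 < p" "p < 1" and w: "w e = logit p"
  shows "matching_measure E w M * edge_kernel p e M M' = matching_measure E w M' * edge_kernel p e M' M"
proof -
  have key: "matching_measure E w N * edge_kernel p e N (insert e N)
      = matching_measure E w (insert e N) * edge_kernel p e (insert e N) N"
    if N: "insert e N \<in> matchings E" "e \<notin> N" for N
  proof -
    have "N = insert e N - {e}" using N(2) by simp
    then have "N \<in> matchings E" using Diff_matching[OF N(1)] by metis
    then have "finite N" by (rule finite_matching[OF fin])
    then have "matching_weight w (insert e N) = p / (1 - p) * matching_weight w N"
      using N(2) p by (simp add: matching_weight_insert w exp_logit)
    moreover have "edge_free N e" "edge_free (insert e N) e"
      using edge_free_matching[OF N(1)] by (auto simp: edge_free_def)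
    then have "edge_kernel p e N (insert e N) = p" "edge_kernel p e (insert e N) N = 1 - p"
      using N(2) by (auto simp: edge_kernel_def)
    ultimately show ?thesis using p by (simp add: matching_measure_eq)
  qed
  \<comment> \<open>In the last case the update at \<open>e\<close> leads neither from
    \<open>M\<close> to \<open>M'\<close> nor back, so both sides are 0.\<close>
  consider "M = M'" | "M' = insert e M" "e \<notin> M" | "M = insert e M'" "e \<notin> M'"
    | "insert e M \<noteq> M'" "M - {e} \<noteq> M'" "insert e M' \<noteq> M" "M' - {e} \<noteq> M"
    by blast
  then show ?thesis
  proof cases
    case 2 then show ?thesis using key[of M] M by simp
  next
    case 3 then show ?thesis using key[of M'] M by simp
  next
    case 4 then show ?thesis by (simp add: edge_kernel_def)
  qed simp
qed

text \<open>Detailed balance for each edge passes to the average over edges. Uniqueness holds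
  because every matching reaches the empty one by deleting its edges one at a time, each time with
  positive probability.\<close>

lemma invariant_distribution_noisy_gibbs_kernel:
  assumes fin: "finite E" and ne: "E \<noteq> {}"
    and P: "\<And>e. e \<in> E \<Longrightarrow> prob_space (P e) \<and> \<xi> e \<in> borel_measurable (P e)"
  shows "invariant_distribution (matchings E) (noisy_gibbs_kernel E P \<xi> w) \<nu>
    \<longleftrightarrow> (\<forall>M\<in>matchings E. \<nu> M = matching_measure E (modified_weight P \<xi> w) M)"
proof -
  let ?K = "noisy_gibbs_kernel E P \<xi> w" and ?p = "modified_prob P \<xi> w"
    and ?\<mu> = "matching_measure E (modified_weight P \<xi> w)"
  have K: "?K M M' = (\<Sum>e\<in>E. edge_kernel (?p e) e M M') / real (card E)" for M M'
    by (rule noisy_gibbs_kernel_eq) (rule P)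
  have p: "0 < ?p e" "?p e < 1" if "e \<in> E" for e
    using P[OF that] modified_prob_bounds by auto
  have c: "0 < real (card E)" using fin ne by (simp add: card_gt_0_iff)
  show ?thesis
  proof (rule invariant_distribution_reversible_iff[where z = "{}"])
    show "finite (matchings E)" by (rule finite_matchings[OF fin])
    show "0 \<le> ?K M M'" for M M'
      unfolding K using p by (intro divide_nonneg_nonneg sum_nonneg edge_kernel_nonneg) (auto intro: less_imp_le)
    show "(\<Sum>M'\<in>matchings E. ?K M M') = 1" if "M \<in> matchings E" for M
    proof -
      have "(\<Sum>M'\<in>matchings E. ?K M M')
        = (\<Sum>e\<in>E. \<Sum>M'\<in>matchings E. edge_kernel (?p e) e M M') / real (card E)"
        unfolding K sum_divide_distrib[symmetric] by (subst sum.swap) simp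
      also have "\<dots> = 1" using c by (simp add: sum_edge_kernel[OF fin _ that])
      finally show ?thesis .
    qed
    show "0 < ?\<mu> M" for M by (rule matching_measure_pos[OF fin])
    show "(\<Sum>M\<in>matchings E. ?\<mu> M) = 1" by (rule sum_matching_measure[OF fin])
    show "?\<mu> M * ?K M M' = ?\<mu> M' * ?K M' M" if "M \<in> matchings E" "M' \<in> matchings E" for M M'
    proof -
      have "(\<Sum>e\<in>E. ?\<mu> M * edge_kernel (?p e) e M M') = (\<Sum>e\<in>E. ?\<mu> M' * edge_kernel (?p e) e M' M)"
        by (intro sum.cong refl edge_kernel_reversible fin that) (auto simp: p modified_weight_def)
      then show ?thesis unfolding K by (simp add: sum_distrib_left)
    qed
    show "(M, {}) \<in> {(x, y). x \<in> matchings E \<and> y \<in> matchings E \<and> 0 < ?K x y}\<^sup>*"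
      (is "_ \<in> ?R\<^sup>*") if M: "M \<in> matchings E" for M
      using finite_matching[OF fin M] M
    proof (induction M)
      case empty
      then show ?case by simp
    next
      case (insert e F)
      have "F = insert e F - {e}" using insert.hyps by simp
      then have F: "F \<in> matchings E" using Diff_matching[OF insert.prems] by metis
      have e: "e \<in> E" using insert.prems by (auto simp: matchings_def)
      have "0 < edge_kernel (?p e) e (insert e F) F"
        using insert.hyps p[OF e] by (auto simp: edge_kernel_def of_bool_def)
      then have "0 < ?K (insert e F) F"
        unfolding K using c p fin e
        by (intro divide_pos_pos sum_pos2[of _ e] edge_kernel_nonneg) (auto intro: less_imp_le)
      then have "(insert e F, F) \<in> ?R" using F insert.prems by simp
      then show ?case using insert.IH[OF F] by (rule converse_rtrancl_into_rtrancl)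
    qed
  qed
qed

section \<open>Comparison of the two matching measures\<close>

lemma finite_bipartite_graph: "bipartite_graph U V E \<Longrightarrow> finite E"
  by (rule finite_subset[of _ "(\<lambda>(u, v). {u, v}) ` (U \<times> V)"]) (auto simp: bipartite_graph_def)

text \<open>The noise threshold keeps each modified weight within 1 of the original one. All weights
  on the segment are then at most \<open>W + 1\<close>, so the total activity at a vertex is at most
  \<open>D * exp (W + 1)\<close>. Squaring the weight deviations produces the fourth powers.\<close>

lemma hellinger_dist_noise_le:
  fixes D W :: real
  assumes graph: "bipartite_graph U V E" and D: "0 < D"
    and deg: "\<And>v. v \<in> U \<union> V \<Longrightarrow> real (vertex_degree E v) \<le> D"
    and W: "\<And>e. e \<in> E \<Longrightarrow> \<bar>w e\<bar> \<le> W"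
    and noise: "\<And>e. e \<in> E \<Longrightarrow> prob_space (P e) \<and> \<xi> e \<in> borel_measurable (P e) \<and>
          integrable (P e) (\<lambda>\<omega>. (\<xi> e \<omega>)\<^sup>2) \<and> (\<integral>\<omega>. \<xi> e \<omega> \<partial>P e) = 0"
    and small: "\<And>e. e \<in> E \<Longrightarrow> (noise_sd (P e) (\<xi> e))\<^sup>2 \<le> logistic (- W) / 4"
  shows "(hellinger_dist (matchings E) (matching_measure E (modified_weight P \<xi> w)) (matching_measure E w))\<^sup>2
    \<le> (1 + 2 * (D * exp (W + 1))) / 4 * (4 / logistic (- W))\<^sup>2 * (\<Sum>e\<in>E. (noise_sd (P e) (\<xi> e)) ^ 4)"
proof -
  let ?w = "modified_weight P \<xi> w" and ?l = "logistic (- W)" and ?B = "D * exp (W + 1)"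
  have fin: "finite E" by (rule finite_bipartite_graph[OF graph])
  have card2: "card e = 2" if "e \<in> E" for e
  proof -
    obtain u v where "e = {u, v}" "u \<in> U" "v \<in> V"
      using \<open>e \<in> E\<close> graph unfolding bipartite_graph_def by blast
    moreover have "U \<inter> V = {}" using graph by (simp add: bipartite_graph_def)
    ultimately have "e = {u, v}" "u \<noteq> v" by blast+
    then show ?thesis by simp
  qed
  have sub: "e \<subseteq> U \<union> V" if "e \<in> E" for e
    using that graph unfolding bipartite_graph_def by blast
  have l: "0 < ?l" by (rule logistic_bounds)
  have dev: "\<bar>?w e - w e\<bar> \<le> 4 / ?l * (noise_sd (P e) (\<xi> e))\<^sup>2" if "e \<in> E" for e
    using noise[OF that] W[OF that] small[OF that] by (intro modified_weight_deviation[where P = P and \<xi> = \<xi> and w = w and e = e and W = W]) auto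
  have dev1: "\<bar>?w e - w e\<bar> \<le> 1" if "e \<in> E" for e
  proof -
    have "4 / ?l * (noise_sd (P e) (\<xi> e))\<^sup>2 \<le> 4 / ?l * (?l / 4)"
      using small[OF that] l by (intro mult_left_mono) auto
    also have "\<dots> = 1" using l by simp
    finally show ?thesis using dev[OF that] by linarith
  qed
  \<comment> \<open>The activity bound is needed at every point of the vertex type; a point outside
    both parts lies on no edge.\<close>
  have deg': "real (card {e \<in> E. u \<in> e}) \<le> D" for u
  proof (cases "u \<in> U \<union> V")
    case True
    then show ?thesis using deg[OF True] by (simp add: vertex_degree_def)
  next
    case False
    then have "{e \<in> E. u \<in> e} = {}" using sub by blast
    then show ?thesis using D by (simp only: card.empty)
  qed
  have "(hellinger_dist (matchings E) (matching_measure E ?w) (matching_measure E w))\<^sup>2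
    \<le> (1 + 2 * ?B) / 4 * (\<Sum>e\<in>E. (?w e - w e)\<^sup>2)"
  proof (rule hellinger_dist_sq_le[OF fin card2])
    fix u and t :: real assume t: "t \<in> {0..1}"
    have "(\<Sum>e\<in>{e \<in> E. u \<in> e}. exp (w e + t * (?w e - w e))) \<le> (\<Sum>e\<in>{e \<in> E. u \<in> e}. exp (W + 1))"
    proof (intro sum_mono)
      fix e assume "e \<in> {e \<in> E. u \<in> e}"
      then have e: "e \<in> E" by simp
      have "\<bar>t * (?w e - w e)\<bar> \<le> 1 * 1"
        unfolding abs_mult using t dev1[OF e] by (intro mult_mono) auto
      then show "exp (w e + t * (?w e - w e)) \<le> exp (W + 1)" using W[OF e] by simp
    qed
    also have "\<dots> = real (card {e \<in> E. u \<in> e}) * exp (W + 1)" by simp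
    also have "\<dots> \<le> ?B" using deg' by (intro mult_right_mono) auto
    finally show "(\<Sum>e\<in>{e \<in> E. u \<in> e}. exp (w e + t * (?w e - w e))) \<le> ?B" .
  qed
  also have "\<dots> \<le> (1 + 2 * ?B) / 4 * (\<Sum>e\<in>E. (4 / ?l)\<^sup>2 * (noise_sd (P e) (\<xi> e)) ^ 4)"
  proof (intro mult_left_mono sum_mono)
    fix e assume "e \<in> E"
    from power_mono[OF dev[OF this], of 2]
    show "(?w e - w e)\<^sup>2 \<le> (4 / ?l)\<^sup>2 * (noise_sd (P e) (\<xi> e)) ^ 4"
      by (simp add: power_mult_distrib power_divide)
  qed (use D in auto)
  finally show ?thesis by (simp add: sum_distrib_left[symmetric] mult.assoc)
qed

section \<open>Convergence along a sequence of graphs\<close>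

lemma eventually_noise_le:
  fixes sd :: "nat \<Rightarrow> 'e \<Rightarrow> real"
  assumes sd: "\<And>N e. e \<in> E N \<Longrightarrow> sd N e \<le> s N"
    and s: "s \<in> o(\<lambda>N. real (card (E N)) powr (- 1 / 4))" and \<epsilon>: "0 < \<epsilon>"
  shows "\<forall>\<^sub>F N in sequentially. \<forall>e\<in>E N. sd N e \<le> \<epsilon> * real (card (E N)) powr (- 1 / 4)"
  using landau_o.smallD[OF s \<epsilon>]
proof eventually_elim
  case (elim N)
  then have "s N \<le> \<epsilon> * real (card (E N)) powr (- 1 / 4)" by simp
  then show ?case using sd order_trans by blast
qed

lemma sum_noise_power4_tendsto_0:
  fixes sd :: "nat \<Rightarrow> 'e \<Rightarrow> real"
  assumes fin: "\<And>N. finite (E N)" and nonneg: "\<And>N e. 0 \<le> sd N e"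
    and sd: "\<And>N e. e \<in> E N \<Longrightarrow> sd N e \<le> s N"
    and s: "s \<in> o(\<lambda>N. real (card (E N)) powr (- 1 / 4))"
  shows "(\<lambda>N. \<Sum>e\<in>E N. sd N e ^ 4) \<longlonglongrightarrow> 0"
proof (rule order_tendstoI)
  fix a :: real assume "a < 0"
  then show "\<forall>\<^sub>F N in sequentially. a < (\<Sum>e\<in>E N. sd N e ^ 4)"
    using nonneg by (intro always_eventually allI less_le_trans[OF _ sum_nonneg]) auto
next
  fix a :: real assume a: "0 < a"
  \<comment> \<open>With this choice each of the \<open>card (E N)\<close> summands is eventually at
    most \<open>a / 2 / card (E N)\<close>.\<close>
  define \<epsilon> where "\<epsilon> = root 4 (a / 2)"
  have \<epsilon>: "0 < \<epsilon>" "\<epsilon> ^ 4 = a / 2" using a by (auto simp: \<epsilon>_def)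
  have "\<forall>\<^sub>F N in sequentially. \<forall>e\<in>E N. sd N e \<le> \<epsilon> * real (card (E N)) powr (- 1 / 4)"
    by (rule eventually_noise_le[OF _ s \<epsilon>(1)]) (rule sd)
  then show "\<forall>\<^sub>F N in sequentially. (\<Sum>e\<in>E N. sd N e ^ 4) < a"
  proof eventually_elim
    case (elim N)
    show ?case
    proof (cases "E N = {}")
      case False
      then have c: "0 < real (card (E N))" using fin[of N] by (auto simp: card_gt_0_iff)
      have "(real (card (E N)) powr (- 1 / 4)) ^ 4 = real (card (E N)) powr (- 1)"
        by (subst powr_power) (use c in auto)
      then have pw: "(\<epsilon> * real (card (E N)) powr (- 1 / 4)) ^ 4 = a / 2 / real (card (E N))"
        by (simp only: power_mult_distrib \<epsilon>(2) powr_neg_one[OF c]) simp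
      have "(\<Sum>e\<in>E N. sd N e ^ 4) \<le> (\<Sum>e\<in>E N. (\<epsilon> * real (card (E N)) powr (- 1 / 4)) ^ 4)"
        using elim nonneg by (intro sum_mono power_mono) auto
      also have "\<dots> = a / 2" unfolding pw using c by simp
      finally show ?thesis using a by simp
    qed (use a in simp)
  qed
qed

text \<open>The quantitative bound needs small noise, which the little-o assumption supplies for all
  large \<open>N\<close>. The squared distances are then squeezed between 0 and a vanishing
  sum.\<close>

lemma hellinger_dist_tendsto_0:
  fixes c C :: real
  assumes fin: "\<And>N. finite (E N)" and nonneg: "\<And>N e. 0 \<le> sd N e"
    and c: "0 < c"
    and bound: "\<And>N. \<forall>e\<in>E N. (sd N e)\<^sup>2 \<le> c \<Longrightarrow>
      (hellinger_dist (S N) (\<nu> N) (\<mu> N))\<^sup>2 \<le> C * (\<Sum>e\<in>E N. sd N e ^ 4)"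
    and sd: "\<And>N e. e \<in> E N \<Longrightarrow> sd N e \<le> s N"
    and s: "s \<in> o(\<lambda>N. real (card (E N)) powr (- 1 / 4))"
  shows "(\<lambda>N. hellinger_dist (S N) (\<nu> N) (\<mu> N)) \<longlonglongrightarrow> 0"
proof -
  let ?d = "\<lambda>N. hellinger_dist (S N) (\<nu> N) (\<mu> N)"
  \<comment> \<open>The constant \<open>sqrt c\<close> suffices: once there is an edge, the power of
    the number of edges is at most 1, and the squares are at most \<open>c\<close>.\<close>
  have ev: "\<forall>\<^sub>F N in sequentially. \<forall>e\<in>E N. sd N e \<le> sqrt c * real (card (E N)) powr (- 1 / 4)"
    by (rule eventually_noise_le[OF _ s]) (simp_all add: sd c)
  have "(\<lambda>N. (?d N)\<^sup>2) \<longlonglongrightarrow> 0"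
  proof (rule tendsto_sandwich[where f = "\<lambda>_. 0"])
    show "\<forall>\<^sub>F N in sequentially. (?d N)\<^sup>2 \<le> C * (\<Sum>e\<in>E N. sd N e ^ 4)"
      using ev
    proof eventually_elim
      case (elim N)
      show ?case
      proof (intro bound ballI)
        fix e assume e: "e \<in> E N"
        then have "card (E N) > 0" using fin[of N] by (auto simp: card_gt_0_iff)
        then have "1 \<le> real (card (E N))" by simp
        then have "real (card (E N)) powr (- 1 / 4) \<le> real (card (E N)) powr 0"
          by (intro powr_mono) auto
        also have "\<dots> \<le> 1" by simp
        finally have "sqrt c * real (card (E N)) powr (- 1 / 4) \<le> sqrt c * 1"
          using c by (intro mult_left_mono) auto
        moreover have "sd N e \<le> sqrt c * real (card (E N)) powr (- 1 / 4)" using elim e by blast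
        ultimately have "sd N e \<le> sqrt c" by linarith
        from power_mono[OF this nonneg, of 2] show "(sd N e)\<^sup>2 \<le> c" using c by simp
      qed
    qed
    have "(\<lambda>N. \<Sum>e\<in>E N. sd N e ^ 4) \<longlonglongrightarrow> 0"
      by (rule sum_noise_power4_tendsto_0[OF fin nonneg _ s]) (rule sd)
    from tendsto_mult_right_zero[OF this]
    show "(\<lambda>N. C * (\<Sum>e\<in>E N. sd N e ^ 4)) \<longlonglongrightarrow> 0" .
  qed auto
  from tendsto_real_sqrt[OF this] show ?thesis
    by (simp add: hellinger_dist_def sum_nonneg)
qed

theorem theorem4p4:
  shows "\<forall>W::real. 0 \<le> W \<longrightarrow> (\<exists>c::real. 0 < c \<and> (\<forall>D::real. 0 < D \<longrightarrow> (\<exists>C::real.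
    \<forall>(U :: nat \<Rightarrow> 'v set) (V :: nat \<Rightarrow> 'v set) (E :: nat \<Rightarrow> 'v set set)
     (w :: nat \<Rightarrow> 'v set \<Rightarrow> real)
     (P :: nat \<Rightarrow> 'v set \<Rightarrow> 'a measure) (\<xi> :: nat \<Rightarrow> 'v set \<Rightarrow> 'a \<Rightarrow> real).
      (\<forall>N. bipartite_graph (U N) (V N) (E N)) \<longrightarrow>
      (\<forall>N. \<forall>v \<in> U N \<union> V N. real (vertex_degree (E N) v) \<le> D) \<longrightarrow>
      (\<forall>N. \<forall>e \<in> E N. \<bar>w N e\<bar> \<le> W) \<longrightarrow>
      (\<forall>N. \<forall>e \<in> E N. prob_space (P N e) \<and> \<xi> N e \<in> borel_measurable (P N e) \<and>
          integrable (P N e) (\<lambda>\<omega>. (\<xi> N e \<omega>)\<^sup>2) \<and> (\<integral>\<omega>. \<xi> N e \<omega> \<partial>P N e) = 0) \<longrightarrow>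
      (\<forall>N. E N \<noteq> {} \<longrightarrow>
        (\<forall>\<nu>. invariant_distribution (matchings (E N)) (noisy_gibbs_kernel (E N) (P N) (\<xi> N) (w N)) \<nu>
          \<longleftrightarrow> (\<forall>M \<in> matchings (E N).
                \<nu> M = matching_measure (E N) (modified_weight (P N) (\<xi> N) (w N)) M))) \<and>
      (\<forall>N. (\<forall>e \<in> E N. (noise_sd (P N e) (\<xi> N e))\<^sup>2 \<le> c) \<longrightarrow>
        (hellinger_dist (matchings (E N))
            (matching_measure (E N) (modified_weight (P N) (\<xi> N) (w N)))
            (matching_measure (E N) (w N)))\<^sup>2
          \<le> C * (\<Sum>e\<in>E N. (noise_sd (P N e) (\<xi> N e)) ^ 4)) \<and>
      (\<forall>s :: nat \<Rightarrow> real.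
        (\<forall>N. \<forall>e \<in> E N. noise_sd (P N e) (\<xi> N e) \<le> s N) \<longrightarrow>
        s \<in> o(\<lambda>N. real (card (E N)) powr (- 1 / 4)) \<longrightarrow>
        (\<lambda>N. hellinger_dist (matchings (E N))
            (matching_measure (E N) (modified_weight (P N) (\<xi> N) (w N)))
            (matching_measure (E N) (w N))) \<longlonglongrightarrow> 0))))"
proof (intro allI impI, goal_cases)
  case (1 W)
  \<comment> \<open>The threshold is chosen before \<open>D\<close> and depends on \<open>W\<close>
    only.\<close>
  let ?c = "logistic (- W) / 4"
  have c: "0 < ?c" using logistic_bounds(1)[of "- W"] by simp
  show ?case
  proof (rule exI[of _ ?c], rule conjI[OF c], intro allI impI, goal_cases)
    case (1 D)
    note D = this
    \<comment> \<open>The first factor is the Hellinger constant for the activity bound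
      \<open>D * exp (W + 1)\<close>, the second the square of the constant in the weight
      deviation.\<close>
    let ?C = "(1 + 2 * (D * exp (W + 1))) / 4 * (4 / logistic (- W))\<^sup>2"
    show ?case
    proof (rule exI[of _ ?C], intro allI impI, goal_cases)
      case (1 U V E w P \<xi>)
      note G = 1(1)[rule_format] and deg = 1(2)[rule_format] and W = 1(3)[rule_format]
        and noise = 1(4)[rule_format]
      have fin: "finite (E N)" for N by (rule finite_bipartite_graph[OF G])
      have bound: "(hellinger_dist (matchings (E N))
          (matching_measure (E N) (modified_weight (P N) (\<xi> N) (w N)))
          (matching_measure (E N) (w N)))\<^sup>2 \<le> ?C * (\<Sum>e\<in>E N. noise_sd (P N e) (\<xi> N e) ^ 4)"
        if "\<forall>e\<in>E N. (noise_sd (P N e) (\<xi> N e))\<^sup>2 \<le> ?c" for N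
        by (rule hellinger_dist_noise_le[where U = "U N" and V = "V N" and E = "E N" and w = "w N"
              and P = "P N" and \<xi> = "\<xi> N" and D = D and W = W])
          (rule G D | erule deg W noise that[rule_format])+
      show ?case
      proof (intro conjI allI impI)
        fix N \<nu> assume "E N \<noteq> {}"
        then show "invariant_distribution (matchings (E N)) (noisy_gibbs_kernel (E N) (P N) (\<xi> N) (w N)) \<nu>
          \<longleftrightarrow> (\<forall>M \<in> matchings (E N).
                \<nu> M = matching_measure (E N) (modified_weight (P N) (\<xi> N) (w N)) M)"

          using noise[of _ N] by (intro invariant_distribution_noisy_gibbs_kernel[where E = "E N"
                and P = "P N" and \<xi> = "\<xi> N" and w = "w N"] fin) blast+
      next
        fix s :: "nat \<Rightarrow> real"
        assume sd: "\<forall>N. \<forall>e \<in> E N. noise_sd (P N e) (\<xi> N e) \<le> s N"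
          and s: "s \<in> o(\<lambda>N. real (card (E N)) powr (- 1 / 4))"
        show "(\<lambda>N. hellinger_dist (matchings (E N))
            (matching_measure (E N) (modified_weight (P N) (\<xi> N) (w N)))
            (matching_measure (E N) (w N))) \<longlonglongrightarrow> 0"
          by (rule hellinger_dist_tendsto_0[where sd = "\<lambda>N e. noise_sd (P N e) (\<xi> N e)"
                and E = E and S = "\<lambda>N. matchings (E N)"
                and \<nu> = "\<lambda>N. matching_measure (E N) (modified_weight (P N) (\<xi> N) (w N))"
                and \<mu> = "\<lambda>N. matching_measure (E N) (w N)" and C = ?C, OF fin _ c bound _ s])
            (use sd in \<open>simp_all add: noise_sd_def\<close>)
      qed (erule bound)
    qed
  qed
qed

end
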